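(* Let $\ell\in\mathbb{N}$. Suppose $\mathfrak{g}\in H^{\ell}$ satisfies (A1) $\operatorname{div}^{k}\mathfrak{g}_{n}>0$ for all $n\geq\ell-k$ and $0\leq k<\ell$; (A2) $(-\Delta)^{\ell-k}\operatorname{div}^{k}\mathfrak{g}_{n}\geq0$ for all $n\geq\ell+1-k$ and $1\leq k<\ell$; (A2') $(-\Delta)^{\ell}\mathfrak{g}_{n}\geq0$ for all $n\geq\ell$; and admits the asymptotic expansion $$\text{(E)}\qquad \mathfrak{g}_{n}=\sum_{j=0}^{2\ell}\alpha_{j}n^{\ell-j-s}+O\left(n^{-\ell-1-s}\right),\quad n\to\infty,$$ for some $\alpha_{j}\in\mathbb{R}$ with $\alpha_{0}\neq0$ and some $s\in(0,1)$. Let $\rho_n(\mathfrak{g}):=(-\Delta)^{\ell}\mathfrak{g}_n/\mathfrak{g}_n$ for $n\geq\ell$. Then: (i) If (E) holds with $s\geq1/2$, then $\rho(\mathfrak{g})$ is critical. (ii) If (E) holds with $s=1/2$, then $\rho(\mathfrak{g})$ is optimal near infinity. (iii) If (E) holds with $s\leq1/2$, $(-\Delta)^{\ell}\mathfrak{g}_{n}>0$ for all $n\geq\ell$, and, in case $\ell\geq2$, also $(-\Delta)^{\ell-1}\operatorname{div}\mathfrak{g}_{n}>0$ for all $n\geq\ell$, then $\rho(\mathfrak{g})$ is non-attainable. In particular, if $\mathfrak{g}$ fulfills (A1), (A2), and the assumptions in (iii) with $s=1/2$, then $\rho(\mathfrak{g})$ is a strictly positive optimal discrete Hardy--Rellich--Birman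 weight.
   Context: $\mathbb{N}=\{1,2,\dots\}$. All sequences are complex sequences indexed by $\mathbb{Z}$. Difference operators on such sequences: $(\nabla u)_{n}:=u_{n}-u_{n-1}$, $(\operatorname{div}u)_{n}:=u_{n+1}-u_{n}$, $(\Delta u)_{n}:=u_{n-1}-2u_{n}+u_{n+1}$. We write $\operatorname{div}^{k}u_{n}$ for $(\operatorname{div}^{k}u)_{n}$, $(-\Delta)^{j}u_n$ for $((-\Delta)^{j}u)_n$, etc.; compositions are written by juxtaposition, and the zeroth power of an operator is the identity. Half-integer powers: $(-\Delta)^{\ell/2}:=(-\Delta)^{m}$ if $\ell=2m$, and $(-\Delta)^{\ell/2}:=\nabla(-\Delta)^{m}$ if $\ell=2m+1$. $\lceil x\rceil$ is the least integer $\geq x$. Spaces: $H^{\ell}:=\{u:\mathbb{Z}\to\mathbb{C}\mid u_{n}=0\text{ for all }n<\ell\}$, and $\mathcal{H}_{0}^{\ell}:=\{u\in H^{\ell}\mid u\text{ has finite support}\}$. A nonnegative sequence $\rho=\{\rho_{n}\}_{n=\ell}^{\infty}$ is a discrete Hardy--Rellich--Birman weight (for the given $\ell$) if $$(\ast)\qquad \sum_{n=\lceil\ell/2\rceil}^{\infty}|(-\Delta)^{\ell/2}u_{n}|^{2}\geq\sum_{n=\ell}^{\infty}\rho_{n}|u_{n}|^{2}\quad\text{for all }u\in\mathcal{H}_{0}^{\ell}.$$ Such a weight $\rho$ is: - critical if, whenever $(\ast)$ holds with $\rho$ replaced by another weight $\tilde\rho$ with $\tilde\rho_n\geq\rho_n$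 for all $n\geq\ell$, then $\tilde\rho_n=\rho_n$ for all $n\geq\ell$; - non-attainable if, whenever the inequality in $(\ast)$ holds as equality for some $u\in H^{\ell}$ such that $\sqrt{\rho}\,u$ is square summable (i.e. the right-hand side of $(\ast)$ is finite), then $u\equiv0$; - optimal near infinity if for every integer $M\geq\ell$ and every $\varepsilon>0$ there exists $u\in\mathcal{H}_{0}^{M}$ such that $\sum_{n=\lceil\ell/2\rceil}^{\infty}|(-\Delta)^{\ell/2}u_{n}|^{2}<(1+\varepsilon)\sum_{n=\ell}^{\infty}\rho_{n}|u_{n}|^{2}$; - optimal if it is critical, non-attainable, and optimal near infinity. *)

theory Defs
  imports "HOL-Analysis.Analysis" "HOL-Library.Landau_Symbols"
begin

definition nabla :: "(int \<Rightarrow> 'a::comm_ring_1) \<Rightarrow> int \<Rightarrow> 'a" where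
  "nabla u = (\<lambda>n. u n - u (n - 1))"

definition dvg :: "(int \<Rightarrow> 'a::comm_ring_1) \<Rightarrow> int \<Rightarrow> 'a" where
  "dvg u = (\<lambda>n. u (n + 1) - u n)"

definition lap :: "(int \<Rightarrow> 'a::comm_ring_1) \<Rightarrow> int \<Rightarrow> 'a" where
  "lap u = (\<lambda>n. u (n - 1) - 2 * u n + u (n + 1))"

definition neg_lap :: "(int \<Rightarrow> 'a::comm_ring_1) \<Rightarrow> int \<Rightarrow> 'a" where
  "neg_lap u = (\<lambda>n. - lap u n)"

text \<open>The half-integer power $(-\Delta)^{l/2}$.\<close>

definition neg_lap_half :: "nat \<Rightarrow> (int \<Rightarrow> 'a::comm_ring_1) \<Rightarrow> int \<Rightarrow> 'a" where
  "neg_lap_half l u =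
     (if even l then (neg_lap ^^ (l div 2)) u else nabla ((neg_lap ^^ (l div 2)) u))"

definition H_space :: "int \<Rightarrow> (int \<Rightarrow> 'a::zero) set" where
  "H_space l = {u. \<forall>n<l. u n = 0}"

definition H0_space :: "int \<Rightarrow> (int \<Rightarrow> 'a::zero) set" where
  "H0_space l = {u \<in> H_space l. finite {n. u n \<noteq> 0}}"

text \<open>
  The two sides of the inequality are sums of nonnegative terms and are taken in the extended
  nonnegative reals, so that a divergent series has the value infinity.  This matters for
  non-attainability, where \<open>u\<close> need not have finite support.  A weight is a sequence indexed by
  \<open>n \<ge> l\<close>; the values of \<open>\<rho> :: int \<Rightarrow> real\<close> at \<open>n < l\<close> are never used.
\<close>

definition birman_lhs :: "nat \<Rightarrow> (int \<Rightarrow> complex) \<Rightarrow> ennreal" where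
  "birman_lhs l u =
     (\<Sum>\<^sub>\<infinity>n\<in>{\<lceil>real l / 2\<rceil>..}. ennreal ((cmod (neg_lap_half l u n))\<^sup>2))"

definition birman_rhs :: "nat \<Rightarrow> (int \<Rightarrow> real) \<Rightarrow> (int \<Rightarrow> complex) \<Rightarrow> ennreal" where
  "birman_rhs l \<rho> u = (\<Sum>\<^sub>\<infinity>n\<in>{int l..}. ennreal (\<rho> n * (cmod (u n))\<^sup>2))"

definition hrb_weight :: "nat \<Rightarrow> (int \<Rightarrow> real) \<Rightarrow> bool" where
  "hrb_weight l \<rho> \<longleftrightarrow>
     (\<forall>n\<ge>int l. 0 \<le> \<rho> n) \<and>
     (\<forall>u\<in>H0_space (int l). birman_lhs l u \<ge> birman_rhs l \<rho> u)"

text \<open>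
  Criticality, non-attainability and optimality near infinity are properties of weights, so each
  of the following predicates includes being a weight.
\<close>

definition critical_weight :: "nat \<Rightarrow> (int \<Rightarrow> real) \<Rightarrow> bool" where
  "critical_weight l \<rho> \<longleftrightarrow>
     hrb_weight l \<rho> \<and>
     (\<forall>\<rho>'. hrb_weight l \<rho>' \<and> (\<forall>n\<ge>int l. \<rho>' n \<ge> \<rho> n) \<longrightarrow> (\<forall>n\<ge>int l. \<rho>' n = \<rho> n))"

definition non_attainable_weight :: "nat \<Rightarrow> (int \<Rightarrow> real) \<Rightarrow> bool" where
  "non_attainable_weight l \<rho> \<longleftrightarrow>
     hrb_weight l \<rho> \<and>
     (\<forall>u\<in>H_space (int l).
        (\<lambda>n. (cmod (complex_of_real (sqrt (\<rho> n)) * u n))\<^sup>2) summable_on {int l..} \<and>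
        birman_lhs l u = birman_rhs l \<rho> u \<longrightarrow> u = (\<lambda>n. 0))"

definition optimal_near_infinity_weight :: "nat \<Rightarrow> (int \<Rightarrow> real) \<Rightarrow> bool" where
  "optimal_near_infinity_weight l \<rho> \<longleftrightarrow>
     hrb_weight l \<rho> \<and>
     (\<forall>M\<ge>int l. \<forall>\<epsilon>::real. \<epsilon> > 0 \<longrightarrow>
        (\<exists>u\<in>H0_space M. birman_lhs l u < ennreal (1 + \<epsilon>) * birman_rhs l \<rho> u))"

definition optimal_weight :: "nat \<Rightarrow> (int \<Rightarrow> real) \<Rightarrow> bool" where
  "optimal_weight l \<rho> \<longleftrightarrow>
     critical_weight l \<rho> \<and> non_attainable_weight l \<rho> \<and> optimal_near_infinity_weight l \<rho>"

definition has_power_expansion :: "nat \<Rightarrow> real \<Rightarrow> (int \<Rightarrow> real) \<Rightarrow> bool" where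
  "has_power_expansion l s g \<longleftrightarrow>
     (\<exists>\<alpha>::nat \<Rightarrow> real. \<alpha> 0 \<noteq> 0 \<and>
        (\<lambda>n::nat. g (int n) - (\<Sum>j=0..2*l. \<alpha> j * real n powr (real l - real j - s)))
          \<in> O(\<lambda>n. real n powr (- real l - 1 - s)))"

definition rho :: "nat \<Rightarrow> (int \<Rightarrow> real) \<Rightarrow> int \<Rightarrow> real" where
  "rho l g n = (neg_lap ^^ l) g n / g n"

end

theory Submission
  imports Defs
begin

text \<open>
  Up to a shift and a sign, the half-integer power of the Laplacian is the difference \<open>dvg\<close> of order
  \<open>l\<close>. The left-hand side of the Birman inequality is therefore the square sum of
  \<open>(dvg ^^ l) u\<close>, and it can be lowered to a weighted square sum of \<open>u\<close> one difference at a
  time. In the step from order \<open>k + 1\<close> to order \<open>k\<close> the positive sequence \<open>h = (dvg ^^ k) g\<close> serves as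
  ground state: with \<open>v = (dvg ^^ k) u\<close>, the identity

    \<open>|v' - v|\<^sup>2 = (h' - h) * (|v'|\<^sup>2 / h' - |v|\<^sup>2 / h) + h * h' * |v' / h' - v / h|\<^sup>2\<close>

  (a prime denotes the next entry) is multiplied by the current weight and summed by parts
  (\<open>ground_state_summation\<close>). Since \<open>- nabla\<close> composed with \<open>dvg\<close> is \<open>neg_lap\<close>, the weight produced at
  order \<open>k\<close> is \<open>neg_lap ^^ (l - k)\<close> of \<open>h\<close>, divided by \<open>h\<close>; the chain starts at the constant
  weight 1 and ends at \<open>rho\<close> (\<open>flux_step\<close>, \<open>energy_expand\<close>). The sign conditions on the differences of \<open>g\<close>
  say that all ground states and weights on the way are nonnegative. So the left-hand side exceeds the right-hand
  side by a sum of nonnegative remainders, one for each \<open>k < l\<close>, and this proves the inequality.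

  Criticality and optimality near infinity come from inserting \<open>g\<close> times a cutoff that decreases
  logarithmically from 1 to 0 on \<open>{1..N}\<close>. By the power expansion, the differences of \<open>g\<close> of order up to \<open>2 * l\<close>
  behave like those of the leading power \<open>n powr (l - s)\<close> (\<open>power_expansion_dvg_tendsto\<close>). Each remainder is a
  weighted square of a Wronskian in which all terms without a difference of the cutoff cancel
  (\<open>wronskian_bound\<close>), so it has size \<open>n powr (- 2 * s) / (ln N)\<^sup>2\<close>. For \<open>s \<ge> 1/2\<close> the sum of the
  remainders is of size \<open>1 / ln N\<close> (\<open>deficit_trial_bound\<close>). As the trial sequences tend to \<open>g\<close>
  pointwise, no larger weight is possible. For \<open>s = 1/2\<close> one also discards the entries with \<open>n < M\<close>. The
  difference of both sides then stays bounded, while the right-hand side grows without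
  bound because \<open>rho l g n * (g n)\<^sup>2\<close> is of size \<open>n powr (- 2 * s)\<close>.

  For non-attainability, the chain of identities is cut at a large index for an arbitrary \<open>u\<close>. The boundary
  terms have a good sign there (\<open>eventually_flux_nonneg\<close>), so equality with a finite value forces the
  remainders with \<open>k = 0\<close> to vanish, and strict positivity of their weight makes \<open>u\<close> a multiple
  of \<open>g\<close>. For \<open>s \<le> 1/2\<close> the right-hand side diverges at \<open>g\<close>, and only the multiple 0 is left.
\<close>

section \<open>Difference calculus\<close>

lemma dvg_funpow_Suc: "(dvg ^^ Suc k) u n = (dvg ^^ k) u (n + 1) - (dvg ^^ k) u n"
  by (simp add: dvg_def)

lemma dvg_funpow_funpow: "(dvg ^^ i) ((dvg ^^ k) u) = (dvg ^^ (i + k)) u"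
  by (simp add: funpow_add)

lemma neg_lap_funpow: "(neg_lap ^^ m) u n = (-1) ^ m * (dvg ^^ (2 * m)) u (n - int m)"
proof (induction m arbitrary: n)
  case (Suc m)
  have "(neg_lap ^^ Suc m) u n = neg_lap ((neg_lap ^^ m) u) n" by simp
  also have "\<dots> = (-1) ^ Suc m * (dvg ^^ Suc (Suc (2 * m))) u (n - 1 - int m)"
    unfolding neg_lap_def lap_def Suc.IH dvg_funpow_Suc by (simp add: algebra_simps)
  finally show ?case by (simp add: algebra_simps)
qed simp

lemma dvg_funpow_add: "(dvg ^^ k) (\<lambda>n. u n + v n) n = (dvg ^^ k) u n + (dvg ^^ k) v n"
  by (induction k arbitrary: n) (simp_all only: dvg_funpow_Suc funpow_0, simp_all)

lemma dvg_funpow_diff: "(dvg ^^ k) (\<lambda>n. u n - v n) n = (dvg ^^ k) u n - (dvg ^^ k) v n"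
  by (induction k arbitrary: n) (simp_all only: dvg_funpow_Suc funpow_0, simp_all)

lemma dvg_funpow_scale: "(dvg ^^ k) (\<lambda>n. c * u n) n = c * (dvg ^^ k) u n"
  by (induction k arbitrary: n) (simp_all only: dvg_funpow_Suc funpow_0, simp_all add: algebra_simps)

lemma dvg_funpow_sum:
  "(dvg ^^ k) (\<lambda>n. \<Sum>j\<in>J. u j n) n = (\<Sum>j\<in>J. (dvg ^^ k) (u j) n)"
  by (induction k arbitrary: n) (simp_all only: dvg_funpow_Suc funpow_0, simp_all add: sum_subtractf)

lemma dvg_funpow_of_real:
  "(dvg ^^ k) (\<lambda>n. complex_of_real (u n)) n = complex_of_real ((dvg ^^ k) u n)"
  by (induction k arbitrary: n) (simp_all only: dvg_funpow_Suc funpow_0, simp_all)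

text \<open>The difference of order \<open>k\<close> at \<open>n\<close> sees only the window \<open>{n..n + k}\<close>. Stating the hypothesis
on this window, and not globally, is what allows sequences to be changed outside of it.\<close>
lemma dvg_funpow_eq_0:
  assumes "\<And>m. n \<le> m \<Longrightarrow> m \<le> n + int k \<Longrightarrow> u m = 0"
  shows "(dvg ^^ k) u n = 0"
  using assms
proof (induction k arbitrary: n)
  case (Suc k)
  then have "(dvg ^^ k) u (n + 1) = 0" "(dvg ^^ k) u n = 0" by auto
  then show ?case by (simp only: dvg_funpow_Suc) simp
qed simp

lemma dvg_funpow_cong:
  assumes "\<And>m. n \<le> m \<Longrightarrow> m \<le> n + int k \<Longrightarrow> u m = v m"
  shows "(dvg ^^ k) u n = (dvg ^^ k) v n"
  using dvg_funpow_eq_0[of n k "\<lambda>m. u m - v m"] assms by (simp add: dvg_funpow_diff)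

lemma dvg_funpow_in_H_space:
  assumes "u \<in> H_space (int l)"
  shows "(dvg ^^ k) u \<in> H_space (int l - int k)"
  using assms by (auto simp: H_space_def intro!: dvg_funpow_eq_0)

lemma abs_dvg_funpow_le:
  fixes u :: "int \<Rightarrow> real"
  assumes "\<And>m. n \<le> m \<Longrightarrow> m \<le> n + int k \<Longrightarrow> \<bar>u m\<bar> \<le> B"
  shows "\<bar>(dvg ^^ k) u n\<bar> \<le> 2 ^ k * B"
  using assms
proof (induction k arbitrary: n)
  case (Suc k)
  have "\<bar>(dvg ^^ k) u (n + 1)\<bar> \<le> 2 ^ k * B" "\<bar>(dvg ^^ k) u n\<bar> \<le> 2 ^ k * B"
    using Suc.prems by (auto intro!: Suc.IH)
  then show ?case by (simp only: dvg_funpow_Suc) simp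
qed simp

text \<open>The discrete Leibniz rule. The shift \<open>n + i\<close> on the second factor comes from
\<open>dvg (a b) n = a n * dvg b n + dvg a n * b (n + 1)\<close>.\<close>
lemma dvg_funpow_mult:
  fixes a b :: "int \<Rightarrow> 'a::comm_ring_1"
  shows "(dvg ^^ m) (\<lambda>n. a n * b n) n =
    (\<Sum>i\<le>m. of_nat (m choose i) * (dvg ^^ i) a n * (dvg ^^ (m - i)) b (n + int i))"
proof (induction m arbitrary: n)
  case (Suc m)
  let ?t = "\<lambda>p i j. of_nat p * (dvg ^^ i) a n * (dvg ^^ j) b (n + int i)"
  have step: "of_nat (m choose i) * (dvg ^^ i) a (n + 1) * (dvg ^^ (m - i)) b (n + 1 + int i)
      - of_nat (m choose i) * (dvg ^^ i) a n * (dvg ^^ (m - i)) b (n + int i)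
      = ?t (m choose i) (Suc i) (m - i) + ?t (m choose i) i (Suc (m - i))" for i
    by (simp only: dvg_funpow_Suc) (simp add: algebra_simps)
  have "(dvg ^^ Suc m) (\<lambda>n. a n * b n) n =
      (\<Sum>i\<le>m. ?t (m choose i) (Suc i) (m - i)) + (\<Sum>i\<le>m. ?t (m choose i) i (Suc (m - i)))"
    by (simp only: dvg_funpow_Suc Suc.IH sum_subtractf[symmetric] step sum.distrib)
  also have "(\<Sum>i\<le>m. ?t (m choose i) i (Suc (m - i)))
      = (\<Sum>i\<le>Suc m. ?t (m choose i) i (Suc m - i))"
    by (simp add: Suc_diff_le binomial_eq_0 del: funpow.simps)
  also have "\<dots> = ?t 1 0 (Suc m) + (\<Sum>i\<le>m. ?t (m choose Suc i) (Suc i) (m - i))"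
    by (subst sum.atMost_Suc_shift) (simp del: funpow.simps)
  also have "(\<Sum>i\<le>m. ?t (m choose Suc i) (Suc i) (m - i))
      = (\<Sum>i\<le>m. ?t (Suc m choose Suc i) (Suc i) (m - i)) - (\<Sum>i\<le>m. ?t (m choose i) (Suc i) (m - i))"
    by (simp add: sum_subtractf[symmetric] algebra_simps binomial_eq_0 del: funpow.simps)
  finally show ?case
    by (subst sum.atMost_Suc_shift) (simp del: funpow.simps)
qed simp

text \<open>A difference of order \<open>m\<close> of a smooth function is a derivative of order \<open>m\<close> at an intermediate
point: each difference operator is traded for a derivative by the mean value theorem, applied to the
difference of lower order. The family \<open>f\<close> lists the successive derivatives.\<close>
lemma forward_difference_mean_value:
  fixes f :: "nat \<Rightarrow> real \<Rightarrow> real"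
  assumes "\<And>j x. x > 0 \<Longrightarrow> (f j has_real_derivative f (Suc j) x) (at x)"
    and "x > 0"
  shows "\<exists>y\<ge>x. y \<le> x + real m \<and> ((\<lambda>\<phi> x. \<phi> (x + 1) - \<phi> x) ^^ m) (f 0) x = f m y"
  using assms(1)
proof (induction m arbitrary: f)
  case (Suc m)
  let ?D = "\<lambda>\<phi> x. \<phi> (x + 1) - \<phi> x :: real"
  have "(?D (f j) has_real_derivative ?D (f (Suc j)) x) (at x)" if "x > 0" for j x
    using Suc.prems[of x j] Suc.prems[of "x + 1" j] that
    by (intro DERIV_diff) (auto simp: DERIV_shift)
  from Suc.IH[of "\<lambda>j. ?D (f j)", OF this] obtain y where y: "y \<ge> x" "y \<le> x + real m"
    "(?D ^^ m) (?D (f 0)) x = ?D (f m) y" by blast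
  obtain z where "z > y" "z < y + 1" "?D (f m) y = (y + 1 - y) * f (Suc m) z"
    using MVT2[of y "y + 1" "f m" "f (Suc m)"] Suc.prems y(1) assms(2) by force
  then show ?case using y by (intro exI[of _ z]) (auto simp: funpow_Suc_right simp del: funpow.simps)
qed (use assms(2) in auto)

lemma dvg_funpow_mean_value:
  fixes f :: "nat \<Rightarrow> real \<Rightarrow> real" and n :: int
  assumes "\<And>j x. x > 0 \<Longrightarrow> (f j has_real_derivative f (Suc j) x) (at x)" and "n > 0"
  obtains y where "real_of_int n \<le> y" "y \<le> real_of_int n + real m"
    "(dvg ^^ m) (\<lambda>k. f 0 (real_of_int k)) n = f m y"
proof -
  have "(dvg ^^ m) (\<lambda>k. \<phi> (real_of_int k)) n
      = ((\<lambda>\<phi> x. \<phi> (x + 1) - \<phi> x) ^^ m) \<phi> (real_of_int n)" for \<phi> :: "real \<Rightarrow> real"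
    by (induction m arbitrary: n) (simp_all add: dvg_def)
  then show ?thesis
    using forward_difference_mean_value[of f "real_of_int n" m] assms that by auto
qed

lemma dvg_funpow_powr:
  fixes n :: int
  assumes "n > 0"
  obtains y where "real_of_int n \<le> y" "y \<le> real_of_int n + real m"
    "(dvg ^^ m) (\<lambda>k. real_of_int k powr a) n = (\<Prod>i<m. a - real i) * y powr (a - real m)"
proof -
  define f where "f j x = (\<Prod>i<j. a - real i) * x powr (a - real j)" for j x
  have "(f j has_real_derivative f (Suc j) x) (at x)" if "x > 0" for j x
    unfolding f_def using that
    by (auto intro!: derivative_eq_intros simp: algebra_simps)
  from dvg_funpow_mean_value[of f n m, OF this assms] that show ?thesis
    by (auto simp: f_def)
qed

lemma abs_dvg_funpow_ln_le:
  fixes n :: int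
  assumes "n > 0" "m > 0"
  shows "\<bar>(dvg ^^ m) (\<lambda>k. ln (real_of_int k)) n\<bar> \<le> fact (m - 1) * real_of_int n powr (- real m)"
proof -
  \<comment> \<open>The derivatives of the logarithm, with the undifferentiated one set apart.\<close>
  define f where "f j x = (case j of 0 \<Rightarrow> ln x
      | Suc i \<Rightarrow> (-1) ^ i * fact i * x powr (- real j))" for j and x :: real
  have "(f j has_real_derivative f (Suc j) x) (at x)" if "x > 0" for j x
    using that unfolding f_def
    by (cases j) (auto intro!: derivative_eq_intros simp: powr_minus field_simps)
  from dvg_funpow_mean_value[of f n m, OF this assms(1)] obtain y
    where y: "real_of_int n \<le> y" "(dvg ^^ m) (\<lambda>k. f 0 (real_of_int k)) n = f m y" by blast
  have "y powr (- real m) \<le> real_of_int n powr (- real m)"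
    using y(1) assms by (intro powr_mono2') auto
  then show ?thesis
    using y(2) assms by (cases m) (auto simp: f_def abs_mult)
qed

section \<open>Power asymptotics of differences\<close>

lemma tendsto_shift_powr:
  fixes f :: "int \<Rightarrow> real"
  assumes "(\<lambda>n::nat. f (int n) / real n powr e) \<longlonglongrightarrow> c"
  shows "(\<lambda>n::nat. f (int n + i) / real n powr e) \<longlonglongrightarrow> c"
proof -
  define q where "q n = nat (int n + i)" for n
  have "filterlim q at_top sequentially"
    unfolding filterlim_at_top
  proof
    fix Z
    show "\<forall>\<^sub>F n in sequentially. Z \<le> q n"
      using eventually_ge_at_top[of "Z + nat \<bar>i\<bar>"] by eventually_elim (auto simp: q_def)
  qed
  with assms have "(\<lambda>n. f (int (q n)) / real (q n) powr e) \<longlonglongrightarrow> c"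
    by (rule filterlim_compose)
  moreover have "(\<lambda>n. (1 + of_int i / real n) powr e) \<longlonglongrightarrow> (1 + 0) powr e"
    by (intro tendsto_intros lim_const_over_n) auto
  ultimately have "(\<lambda>n. f (int (q n)) / real (q n) powr e * (1 + of_int i / real n) powr e)
      \<longlonglongrightarrow> c * (1 + 0) powr e"
    by (rule tendsto_mult)
  moreover have "\<forall>\<^sub>F n in sequentially. f (int (q n)) / real (q n) powr e * (1 + of_int i / real n) powr e
      = f (int n + i) / real n powr e"
    using eventually_gt_at_top[of "nat \<bar>i\<bar>"]
  proof eventually_elim
    case (elim n)
    then have n: "n > 0" "int n + i > 0" by auto
    then have "real (q n) = real n * (1 + of_int i / real n)"
      by (simp add: q_def field_simps)
    moreover have "1 + of_int i / real n > 0"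
      using n by (simp add: field_simps)
    ultimately show ?case using n by (simp add: powr_mult) (simp add: q_def)
  qed
  ultimately show ?thesis by (simp add: tendsto_cong)
qed

text \<open>Differences do not improve the order of a remainder about which only the size is known; this is why
the error of the expansion has to be smaller than \<open>n powr (- l - s)\<close>, the size of the difference of
order \<open>2 * l\<close>.\<close>
lemma tendsto_0_dvg_funpow:
  fixes r :: "int \<Rightarrow> real"
  assumes "(\<lambda>n::nat. r (int n) / real n powr e) \<longlonglongrightarrow> 0"
  shows "(\<lambda>n::nat. (dvg ^^ m) r (int n) / real n powr e) \<longlonglongrightarrow> 0"
proof (induction m)
  case (Suc m)
  from tendsto_diff[OF tendsto_shift_powr[OF Suc, of 1] Suc] show ?case
    by (simp only: dvg_funpow_Suc diff_divide_distrib) simp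
qed (use assms in simp)

lemma tendsto_dvg_funpow_powr:
  "(\<lambda>n::nat. (dvg ^^ m) (\<lambda>k. real_of_int k powr a) (int n) / real n powr (a - real m))
    \<longlonglongrightarrow> (\<Prod>i<m. a - real i)"
proof -
  have "\<exists>y. real n \<le> y \<and> y \<le> real n + real m \<and>
      (dvg ^^ m) (\<lambda>k. real_of_int k powr a) (int n) = (\<Prod>i<m. a - real i) * y powr (a - real m)"
    if "n > 0" for n :: nat
    using dvg_funpow_powr[of "int n" m a] that by auto
  then obtain y where y: "\<And>n. n > 0 \<Longrightarrow> real n \<le> y n" "\<And>n. n > 0 \<Longrightarrow> y n \<le> real n + real m"
    "\<And>n. n > 0 \<Longrightarrow> (dvg ^^ m) (\<lambda>k. real_of_int k powr a) (int n)
        = (\<Prod>i<m. a - real i) * y n powr (a - real m)"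
    by metis
  have "(\<lambda>n. y n / real n) \<longlonglongrightarrow> 1"
  proof (rule tendsto_sandwich)
    show "\<forall>\<^sub>F n in sequentially. 1 \<le> y n / real n"
      using eventually_gt_at_top[of 0] by eventually_elim (use y(1) in \<open>simp add: field_simps\<close>)
    show "\<forall>\<^sub>F n in sequentially. y n / real n \<le> 1 + real m / real n"
      using eventually_gt_at_top[of 0] by eventually_elim (use y(2) in \<open>simp add: field_simps\<close>)
    have "(\<lambda>n. 1 + real m / real n) \<longlonglongrightarrow> 1 + 0"
      by (intro tendsto_intros lim_const_over_n)
    then show "(\<lambda>n. 1 + real m / real n) \<longlonglongrightarrow> 1" by simp
  qed auto
  then have "(\<lambda>n. (\<Prod>i<m. a - real i) * (y n / real n) powr (a - real m))
      \<longlonglongrightarrow> (\<Prod>i<m. a - real i) * 1 powr (a - real m)"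
    by (intro tendsto_intros) auto
  moreover have "\<forall>\<^sub>F n in sequentially. (\<Prod>i<m. a - real i) * (y n / real n) powr (a - real m)
      = (dvg ^^ m) (\<lambda>k. real_of_int k powr a) (int n) / real n powr (a - real m)"
    using eventually_gt_at_top[of 0]
  proof eventually_elim
    case (elim n)
    then show ?case using y(1,3)[of n] by (simp add: powr_divide)
  qed
  ultimately show ?thesis by (simp add: tendsto_cong)
qed

text \<open>The expansion may be differenced up to order \<open>2 * l\<close>: the leading power dominates the lower powers,
and its difference of order \<open>m\<close>, of size \<open>n powr (l - s - m)\<close>, still dominates the error term, of size
\<open>n powr (- l - 1 - s)\<close>.\<close>
lemma power_expansion_dvg_tendsto:
  assumes "has_power_expansion l s g"
  shows "\<exists>c. c \<noteq> 0 \<and> (\<forall>m\<le>2 * l.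
    (\<lambda>n::nat. (dvg ^^ m) g (int n) / real n powr (real l - s - real m))
      \<longlonglongrightarrow> c * (\<Prod>i<m. real l - s - real i))"
proof -
  define \<gamma> where "\<gamma> = real l - s"
  from assms obtain \<alpha> where \<alpha>: "\<alpha> 0 \<noteq> 0" and
    O: "(\<lambda>n::nat. g (int n) - (\<Sum>j=0..2*l. \<alpha> j * real n powr (real l - real j - s)))
          \<in> O(\<lambda>n. real n powr (- real l - 1 - s))"
    unfolding has_power_expansion_def by blast
  define P where "P n = (\<Sum>j\<le>2*l. \<alpha> j * real_of_int n powr (\<gamma> - real j))" for n
  define r where "r n = g n - P n" for n
  have rO: "(\<lambda>n::nat. r (int n)) \<in> O(\<lambda>n. real n powr (\<gamma> - 2 * real l - 1))"
  proof -
    have "real l - real j - s = \<gamma> - real j" "- real l - 1 - s = \<gamma> - 2 * real l - 1" for j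
      by (simp_all add: \<gamma>_def)
    then show ?thesis
      using O unfolding r_def P_def atLeast0AtMost by (simp only: of_int_of_nat_eq)
  qed
  have lim: "(\<lambda>n::nat. (dvg ^^ m) g (int n) / real n powr (\<gamma> - real m))
      \<longlonglongrightarrow> \<alpha> 0 * (\<Prod>i<m. \<gamma> - real i)" if m: "m \<le> 2 * l" for m
  proof -
    have vanish: "(\<lambda>n. real n powr (- b)) \<longlonglongrightarrow> 0" if "b > 0" for b :: real
      using that by (intro tendsto_neg_powr filterlim_real_sequentially) auto
    have "(\<lambda>n. real n powr (\<gamma> - 2 * real l - 1)) \<in> o(\<lambda>n. real n powr (\<gamma> - real m))"
    proof (rule smalloI_tendsto)
      have "(\<lambda>n. real n powr (- (2 * real l + 1 - real m))) \<longlonglongrightarrow> 0"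
        using m by (intro vanish) auto
      then show "(\<lambda>n. real n powr (\<gamma> - 2 * real l - 1) / real n powr (\<gamma> - real m)) \<longlonglongrightarrow> 0"
        by (simp add: powr_diff[symmetric] algebra_simps)
      show "\<forall>\<^sub>F n in sequentially. real n powr (\<gamma> - real m) \<noteq> 0"
        using eventually_gt_at_top[of 0] by eventually_elim auto
    qed
    with rO have "(\<lambda>n::nat. r (int n)) \<in> o(\<lambda>n. real n powr (\<gamma> - real m))"
      by (rule landau_o.big_small_trans)
    then have r0: "(\<lambda>n::nat. (dvg ^^ m) r (int n) / real n powr (\<gamma> - real m)) \<longlonglongrightarrow> 0"
      by (intro tendsto_0_dvg_funpow smalloD_tendsto)
    have P: "(\<lambda>n::nat. (dvg ^^ m) (\<lambda>k. real_of_int k powr (\<gamma> - real j)) (int n) / real n powr (\<gamma> - real m))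
        \<longlonglongrightarrow> (if j = 0 then \<Prod>i<m. \<gamma> - real i else 0)" for j
    proof (cases "j = 0")
      case True
      then show ?thesis using tendsto_dvg_funpow_powr[of m \<gamma>] by simp
    next
      case False
      have "(\<lambda>n::nat. (dvg ^^ m) (\<lambda>k. real_of_int k powr (\<gamma> - real j)) (int n)
            / real n powr (\<gamma> - real j - real m) * real n powr (- real j))
          \<longlonglongrightarrow> (\<Prod>i<m. \<gamma> - real j - real i) * 0"
        using False by (intro tendsto_mult tendsto_dvg_funpow_powr vanish) auto
      moreover have "x / real n powr (\<gamma> - real j - real m) * real n powr (- real j)
          = x / real n powr (\<gamma> - real m)" for x n
        by (cases "n = 0") (simp_all add: powr_diff powr_minus powr_add field_simps)
      ultimately show ?thesis using False by simp
    qed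
    have "(\<lambda>n::nat. (\<Sum>j\<le>2*l. \<alpha> j * ((dvg ^^ m) (\<lambda>k. real_of_int k powr (\<gamma> - real j)) (int n)
            / real n powr (\<gamma> - real m))) + (dvg ^^ m) r (int n) / real n powr (\<gamma> - real m))
        \<longlonglongrightarrow> (\<Sum>j\<le>2*l. \<alpha> j * (if j = 0 then \<Prod>i<m. \<gamma> - real i else 0)) + 0"
      by (intro tendsto_intros P r0)
    moreover have "(dvg ^^ m) g n = (\<Sum>j\<le>2*l. \<alpha> j * (dvg ^^ m) (\<lambda>k. real_of_int k powr (\<gamma> - real j)) n)
        + (dvg ^^ m) r n" for n
    proof -
      have "(dvg ^^ m) g n = (dvg ^^ m) (\<lambda>n. P n + r n) n" by (simp add: r_def)
      then show ?thesis
        by (simp only: dvg_funpow_add) (simp add: P_def dvg_funpow_sum dvg_funpow_scale)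
    qed
    ultimately show ?thesis
      by (simp add: add_divide_distrib sum_divide_distrib if_distrib cong: if_cong)
  qed
  show ?thesis using \<alpha> lim unfolding \<gamma>_def by (intro exI[of _ "\<alpha> 0"] conjI allI impI)
qed

text \<open>Asymptotic bounds are turned into bounds at every \<open>n \<ge> 1\<close>, so that later estimates need no
bookkeeping of thresholds.\<close>
lemma powr_bound_of_tendsto:
  fixes f :: "int \<Rightarrow> real"
  assumes "(\<lambda>n::nat. f (int n) / real n powr e) \<longlonglongrightarrow> c"
  shows "\<exists>C. \<forall>n\<ge>1. \<bar>f n\<bar> \<le> C * real_of_int n powr e"
proof -
  from assms have "Bseq (\<lambda>n::nat. f (int n) / real n powr e)"
    using convergentI convergent_imp_Bseq by blast
  then obtain K where K: "\<And>n::nat. \<bar>f (int n) / real n powr e\<bar> \<le> K"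
    unfolding Bseq_def by auto
  have "\<bar>f n\<bar> \<le> K * real_of_int n powr e" if "n \<ge> 1" for n
    using K[of "nat n"] that by (simp add: abs_divide divide_le_eq)
  then show ?thesis by blast
qed

lemma uniform_bound_finite:
  fixes f b :: "'i \<Rightarrow> int \<Rightarrow> real"
  assumes "finite I" "\<And>i. i \<in> I \<Longrightarrow> \<exists>C. \<forall>n\<in>X i. f i n \<le> C * b i n"
    and nonneg: "\<And>i n. i \<in> I \<Longrightarrow> n \<in> X i \<Longrightarrow> 0 \<le> b i n"
  shows "\<exists>C>0. \<forall>i\<in>I. \<forall>n\<in>X i. f i n \<le> C * b i n"
proof -
  from assms(2) obtain C where C: "\<And>i n. i \<in> I \<Longrightarrow> n \<in> X i \<Longrightarrow> f i n \<le> C i * b i n"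
    by metis
  define K where "K = 1 + (\<Sum>i\<in>I. \<bar>C i\<bar>)"
  have "f i n \<le> K * b i n" if "i \<in> I" "n \<in> X i" for i n
  proof -
    have "\<bar>C i\<bar> \<le> (\<Sum>i\<in>I. \<bar>C i\<bar>)" using that assms(1) by (intro member_le_sum) auto
    then have "C i \<le> K" by (auto simp: K_def)
    then show ?thesis using C[OF that] nonneg[OF that] by (meson mult_right_mono order_trans)
  qed
  moreover have "K > 0" unfolding K_def by (intro add_pos_nonneg sum_nonneg) auto
  ultimately show ?thesis by blast
qed

section \<open>Logarithmic cutoffs\<close>

text \<open>The descent from 1 to 0 over \<open>{1..N}\<close> is spread over a logarithmic scale. Up to a constant, this
makes the difference of order \<open>i \<ge> 1\<close> smaller than \<open>n powr (- i)\<close> by the factor \<open>1 / ln N\<close>,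
which is what the borderline exponent \<open>s = 1/2\<close> requires. The power \<open>p\<close> makes the corner at \<open>N\<close> smooth enough for differences up to order
\<open>p\<close>.\<close>
definition log_cutoff :: "nat \<Rightarrow> int \<Rightarrow> int \<Rightarrow> real" where
  "log_cutoff p N n = (max 0 (1 - ln (real_of_int n) / ln (real_of_int N))) ^ p"

text \<open>The bounds expected from the cutoff, on those windows that stay left of the corner at \<open>N\<close>. The
gain \<open>1 / ln N\<close> is only available for differences of positive order. Phrased like this, the
property is stable under products, uniformly in \<open>N\<close>.\<close>
definition slowly_varying :: "nat \<Rightarrow> int \<Rightarrow> real \<Rightarrow> (int \<Rightarrow> real) \<Rightarrow> bool" where
  "slowly_varying p N A a \<longleftrightarrow> (\<forall>n\<ge>1. \<forall>i\<le>p. n + int i \<le> N \<longrightarrow>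
     \<bar>(dvg ^^ i) a n\<bar> \<le> A * real_of_int n powr (- real i) * (if i = 0 then 1 else 1 / ln (real_of_int N)))"

lemma ln_ge_1:
  assumes "(3::int) \<le> N" shows "1 \<le> ln (real_of_int N)"
proof -
  have "exp 1 \<le> real_of_int N" using exp_le assms by linarith
  then show ?thesis using assms by (subst ln_ge_iff) auto
qed

text \<open>The constant doubles with every difference because the binomial coefficients of the Leibniz rule add up
to a power of 2. A product of two gains is at least as good as a single one, since \<open>ln N \<ge> 1\<close>.\<close>
lemma slowly_varying_mult:
  assumes N: "3 \<le> N" and A: "slowly_varying p N A a" "0 \<le> A" and B: "slowly_varying p N B b" "0 \<le> B"
  shows "slowly_varying p N (2 ^ p * (A * B)) (\<lambda>n. a n * b n)"
  unfolding slowly_varying_def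
proof (intro allI impI)
  fix n :: int and i :: nat
  assume n: "1 \<le> n" and i: "i \<le> p" "n + int i \<le> N"
  define \<theta> :: "nat \<Rightarrow> real" where "\<theta> j = (if j = 0 then 1 else 1 / ln (real_of_int N))" for j
  have L: "1 \<le> ln (real_of_int N)" by (rule ln_ge_1[OF N])
  have \<theta>_nonneg: "0 \<le> \<theta> j" for j using L by (simp add: \<theta>_def)
  have \<theta>_mult: "\<theta> j * \<theta> k \<le> \<theta> (j + k)" for j k
    using L by (auto simp: \<theta>_def divide_le_eq)
  have bound: "\<bar>(dvg ^^ j) a n * (dvg ^^ (i - j)) b (n + int j)\<bar>
      \<le> A * B * (real_of_int n powr (- real i) * \<theta> i)" if j: "j \<le> i" for j
  proof -
    have "\<bar>(dvg ^^ (i - j)) b (n + int j)\<bar>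
        \<le> B * real_of_int (n + int j) powr (- real (i - j)) * \<theta> (i - j)"
      using B(1)[unfolded slowly_varying_def, rule_format, of "n + int j" "i - j"] n i j
      unfolding \<theta>_def by simp
    also have "\<dots> \<le> B * real_of_int n powr (- real (i - j)) * \<theta> (i - j)"
      using B(2) n \<theta>_nonneg by (intro mult_right_mono mult_left_mono powr_mono2') auto
    finally have b: "\<bar>(dvg ^^ (i - j)) b (n + int j)\<bar>
        \<le> B * real_of_int n powr (- real (i - j)) * \<theta> (i - j)" .
    have a: "\<bar>(dvg ^^ j) a n\<bar> \<le> A * real_of_int n powr (- real j) * \<theta> j"
      using A(1) n i j unfolding slowly_varying_def \<theta>_def by auto
    have "\<bar>(dvg ^^ j) a n\<bar> * \<bar>(dvg ^^ (i - j)) b (n + int j)\<bar>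
        \<le> (A * real_of_int n powr (- real j) * \<theta> j) * (B * real_of_int n powr (- real (i - j)) * \<theta> (i - j))"
      using A(2) \<theta>_nonneg by (intro mult_mono a b) auto
    also have "\<dots> = A * B * (real_of_int n powr (- real j) * real_of_int n powr (- real (i - j))) * (\<theta> j * \<theta> (i - j))"
      by (simp only: mult_ac)
    also have "real_of_int n powr (- real j) * real_of_int n powr (- real (i - j)) = real_of_int n powr (- real i)"
      using j by (simp add: powr_add[symmetric] of_nat_diff)
    also have "A * B * real_of_int n powr (- real i) * (\<theta> j * \<theta> (i - j))
        \<le> A * B * real_of_int n powr (- real i) * \<theta> i"
      using \<theta>_mult[of j "i - j"] j A(2) B(2) by (intro mult_left_mono) auto
    finally show ?thesis by (simp add: abs_mult mult_ac)
  qed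
  have "\<bar>(dvg ^^ i) (\<lambda>n. a n * b n) n\<bar>
      \<le> (\<Sum>j\<le>i. \<bar>of_nat (i choose j) * (dvg ^^ j) a n * (dvg ^^ (i - j)) b (n + int j)\<bar>)"
    unfolding dvg_funpow_mult by (rule sum_abs)
  also have "\<dots> \<le> (\<Sum>j\<le>i. real (i choose j) * (A * B * (real_of_int n powr (- real i) * \<theta> i)))"
    using bound by (intro sum_mono) (simp add: abs_mult mult.assoc mult_left_mono)
  also have "\<dots> = 2 ^ i * (A * B * (real_of_int n powr (- real i) * \<theta> i))"
    by (simp add: sum_distrib_right[symmetric] choose_row_sum of_nat_sum[symmetric] del: of_nat_sum)
  also have "\<dots> \<le> 2 ^ p * (A * B * (real_of_int n powr (- real i) * \<theta> i))"
    using i(1) A(2) B(2) \<theta>_nonneg by (intro mult_right_mono power_increasing mult_nonneg_nonneg) auto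
  finally show "\<bar>(dvg ^^ i) (\<lambda>n. a n * b n) n\<bar> \<le> 2 ^ p * (A * B) * real_of_int n powr (- real i) *
      (if i = 0 then 1 else 1 / ln (real_of_int N))"
    by (simp add: \<theta>_def mult.assoc)
qed

lemma slowly_varying_log:
  assumes N: "3 \<le> N"
  shows "slowly_varying p N (fact p) (\<lambda>n. 1 - ln (real_of_int n) / ln (real_of_int N))"
  unfolding slowly_varying_def
proof (intro allI impI)
  fix n :: int and i :: nat
  assume n: "1 \<le> n" and i: "i \<le> p" "n + int i \<le> N"
  have L: "1 \<le> ln (real_of_int N)" by (rule ln_ge_1[OF N])
  show "\<bar>(dvg ^^ i) (\<lambda>n. 1 - ln (real_of_int n) / ln (real_of_int N)) n\<bar>
      \<le> fact p * real_of_int n powr (- real i) * (if i = 0 then 1 else 1 / ln (real_of_int N))"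
  proof (cases "i = 0")
    case True
    have "\<bar>1 - ln (real_of_int n) / ln (real_of_int N)\<bar> \<le> 1"
      using n i L by (simp add: abs_le_iff divide_le_eq)
    also have "(1::real) \<le> fact p" by simp
    finally show ?thesis using True n by simp
  next
    case False
    have "(dvg ^^ i) (\<lambda>n. 1 - ln (real_of_int n) / ln (real_of_int N)) n
        = - (1 / ln (real_of_int N)) * (dvg ^^ i) (\<lambda>n. ln (real_of_int n)) n"
    proof -
      have "(dvg ^^ i) (\<lambda>n. 1 :: real) n = 0"
      proof -
        obtain j where "i = Suc j" using False by (cases i) auto
        then show ?thesis
          by (simp only: funpow_Suc_right o_apply) (simp add: dvg_def dvg_funpow_eq_0)
      qed
      then show ?thesis
        using dvg_funpow_diff[of i "\<lambda>n. 1" "\<lambda>n. 1 / ln (real_of_int N) * ln (real_of_int n)" n]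
        by (simp only: dvg_funpow_scale) simp
    qed
    then have "\<bar>(dvg ^^ i) (\<lambda>n. 1 - ln (real_of_int n) / ln (real_of_int N)) n\<bar>
        = \<bar>(dvg ^^ i) (\<lambda>n. ln (real_of_int n)) n\<bar> / ln (real_of_int N)"
      using L by (simp add: abs_mult)
    also have "\<dots> \<le> fact (i - 1) * real_of_int n powr (- real i) / ln (real_of_int N)"
      using n False L by (intro divide_right_mono abs_dvg_funpow_ln_le) auto
    also have "\<dots> \<le> fact p * real_of_int n powr (- real i) / ln (real_of_int N)"
      using i L by (intro divide_right_mono mult_right_mono fact_mono) auto
    finally show ?thesis using False by simp
  qed
qed

lemma slowly_varying_log_power:
  "\<exists>A>0. \<forall>N\<ge>3. slowly_varying p N A (\<lambda>n. (1 - ln (real_of_int n) / ln (real_of_int N)) ^ q)"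
proof (induction q)
  case 0
  have "slowly_varying p N 1 (\<lambda>n. 1)" if "3 \<le> N" for N
    unfolding slowly_varying_def
  proof (intro allI impI)
    fix n :: int and i assume "1 \<le> n"
    then show "\<bar>(dvg ^^ i) (\<lambda>n. 1) n\<bar> \<le> 1 * real_of_int n powr - real i *
        (if i = 0 then 1 else 1 / ln (real_of_int N))"
      using ln_ge_1[OF that]
      by (cases i) (simp_all add: funpow_Suc_right dvg_def[of "\<lambda>n. 1"] dvg_funpow_eq_0 del: funpow.simps(2))
  qed
  then show ?case by (intro exI[of _ 1]) auto
next
  case (Suc q)
  then obtain A where A: "A > 0"
    "\<And>N. 3 \<le> N \<Longrightarrow> slowly_varying p N A (\<lambda>n. (1 - ln (real_of_int n) / ln (real_of_int N)) ^ q)"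
    by blast
  have "slowly_varying p N (2 ^ p * (fact p * A)) (\<lambda>n. (1 - ln (real_of_int n) / ln (real_of_int N)) ^ Suc q)"
    if "3 \<le> N" for N
    using slowly_varying_mult[OF that slowly_varying_log[OF that, of p] _ A(2)[OF that]] A(1) by simp
  then show ?case using A(1) by (intro exI[of _ "2 ^ p * (fact p * A)"]) auto
qed

lemma log_cutoff_eq_0: "3 \<le> N \<Longrightarrow> N \<le> n \<Longrightarrow> 0 < p \<Longrightarrow> log_cutoff p N n = 0"
  using ln_ge_1[of N] by (simp add: log_cutoff_def)

lemma log_cutoff_tendsto_1:
  "(\<lambda>N::nat. log_cutoff p (int N) n) \<longlonglongrightarrow> 1"
proof -
  have "(\<lambda>N::nat. ln (real_of_int n) / ln (real N)) \<longlonglongrightarrow> 0"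
    by (intro real_tendsto_divide_at_top[OF tendsto_const] filterlim_compose[OF ln_at_top]
        filterlim_real_sequentially)
  then have "(\<lambda>N::nat. (max 0 (1 - ln (real_of_int n) / ln (real N))) ^ p) \<longlonglongrightarrow> (max 0 (1 - 0)) ^ p"
    by (intro tendsto_intros)
  then show ?thesis by (simp add: log_cutoff_def)
qed

text \<open>At distance at most \<open>p\<close> from the corner, the base of the cutoff is at most \<open>p / (n * ln N)\<close>, and its
power \<open>p\<close> is so small that no cancellation in the differences is needed there.\<close>
lemma log_cutoff_near_edge:
  assumes N: "3 \<le> N" and n: "1 \<le> n" "n \<le> m" and d: "N \<le> n + int d" and dp: "d \<le> p" and p: "0 < p"
  shows "log_cutoff p N m \<le> real p ^ p * real_of_int n powr (- real p) / ln (real_of_int N)"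
proof (cases "N \<le> m")
  case True
  then show ?thesis using log_cutoff_eq_0[OF N True p] ln_ge_1[OF N] by simp
next
  case False
  define L where "L = ln (real_of_int N)"
  have L: "1 \<le> L" unfolding L_def by (rule ln_ge_1[OF N])
  have m: "1 \<le> m" "m < N" using n False by auto
  have "L - ln (real_of_int m) = ln (real_of_int N / real_of_int m)"
    using m by (simp add: L_def ln_div)
  also have "\<dots> \<le> real_of_int N / real_of_int m - 1"
    using m by (intro ln_le_minus_one) auto
  also have "\<dots> = real_of_int (N - m) / real_of_int m"
    using m by (simp add: field_simps)
  also have "\<dots> \<le> real p / real_of_int n"
    using m n d dp by (intro frac_le) auto
  finally have "(L - ln (real_of_int m)) / L \<le> (real p / real_of_int n) / L"
    using L by (intro divide_right_mono) auto
  moreover have "(L - ln (real_of_int m)) / L = 1 - ln (real_of_int m) / L"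
    using L by (simp add: field_simps)
  ultimately have "max 0 (1 - ln (real_of_int m) / L) \<le> real p / real_of_int n / L"
    using L n by auto
  then have "log_cutoff p N m \<le> (real p / real_of_int n / L) ^ p"
    unfolding log_cutoff_def L_def[symmetric] by (intro power_mono) auto
  also have "\<dots> = real p ^ p * real_of_int n powr (- real p) / L ^ p"
    using n by (simp add: power_divide powr_minus powr_realpow field_simps)
  also have "\<dots> \<le> real p ^ p * real_of_int n powr (- real p) / L"
    using L p self_le_power[of L p] by (intro divide_left_mono) auto
  finally show ?thesis by (simp add: L_def)
qed

lemma log_cutoff_nonneg: "0 \<le> log_cutoff p N n"
  by (simp add: log_cutoff_def)

text \<open>A window left of the corner is covered by the product rule; a window that meets the corner is
covered by the smallness of the cutoff itself.\<close>
lemma dvg_log_cutoff_bound: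
  "\<exists>B>0. \<forall>N\<ge>3. \<forall>n\<ge>1. \<forall>i. 1 \<le> i \<and> i \<le> p \<longrightarrow>
     \<bar>(dvg ^^ i) (log_cutoff p N) n\<bar> \<le> B * real_of_int n powr (- real i) / ln (real_of_int N)"
proof -
  obtain A where A: "A > 0"
    "\<And>N. 3 \<le> N \<Longrightarrow> slowly_varying p N A (\<lambda>n. (1 - ln (real_of_int n) / ln (real_of_int N)) ^ p)"
    using slowly_varying_log_power by blast
  define B where "B = A + 2 ^ p * real p ^ p"
  have "\<bar>(dvg ^^ i) (log_cutoff p N) n\<bar> \<le> B * real_of_int n powr (- real i) / ln (real_of_int N)"
    if N: "3 \<le> N" and n: "1 \<le> n" and i: "1 \<le> i" "i \<le> p" for N n i
  proof -
    have L: "1 \<le> ln (real_of_int N)" by (rule ln_ge_1[OF N])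
    show ?thesis
    proof (cases "n + int i \<le> N")
      case True
      have "(dvg ^^ i) (log_cutoff p N) n
          = (dvg ^^ i) (\<lambda>n. (1 - ln (real_of_int n) / ln (real_of_int N)) ^ p) n"
      proof (rule dvg_funpow_cong)
        fix m assume "n \<le> m" "m \<le> n + int i"
        then have "ln (real_of_int m) \<le> ln (real_of_int N)" using True n by simp
        then show "log_cutoff p N m = (1 - ln (real_of_int m) / ln (real_of_int N)) ^ p"
          using L by (simp add: log_cutoff_def max_def divide_le_eq)
      qed
      also have "\<bar>\<dots>\<bar> \<le> A * real_of_int n powr (- real i) * (1 / ln (real_of_int N))"
        using A(2)[OF N] n i True unfolding slowly_varying_def by fastforce
      also have "\<dots> \<le> B * real_of_int n powr (- real i) * (1 / ln (real_of_int N))"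
        using L by (intro mult_right_mono) (auto simp: B_def)
      finally show ?thesis by simp
    next
      case False
      have "\<bar>(dvg ^^ i) (log_cutoff p N) n\<bar>
          \<le> 2 ^ i * (real p ^ p * real_of_int n powr (- real p) / ln (real_of_int N))"
      proof (rule abs_dvg_funpow_le)
        fix m assume "n \<le> m"
        then have "log_cutoff p N m \<le> real p ^ p * real_of_int n powr (- real p) / ln (real_of_int N)"
          using False N n i by (intro log_cutoff_near_edge[where d = i]) auto
        then show "\<bar>log_cutoff p N m\<bar> \<le> real p ^ p * real_of_int n powr (- real p) / ln (real_of_int N)"
          using log_cutoff_nonneg[of p N m] by simp
      qed
      also have "\<dots> = 2 ^ i * real p ^ p * real_of_int n powr (- real p) / ln (real_of_int N)"
        by simp
      also have "\<dots> \<le> B * real_of_int n powr (- real i) / ln (real_of_int N)"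
      proof (intro divide_right_mono mult_mono)
        have "2 ^ i * real p ^ p \<le> 2 ^ p * real p ^ p"
          using i by (intro mult_right_mono power_increasing) auto
        then show "2 ^ i * real p ^ p \<le> B" using A(1) by (simp add: B_def)
        show "real_of_int n powr (- real p) \<le> real_of_int n powr (- real i)"
          using n i by (intro powr_mono) auto
      qed (use A(1) L in \<open>auto simp: B_def\<close>)
      finally show ?thesis .
    qed
  qed
  moreover have "B > 0" using A(1) by (auto simp: B_def intro: add_pos_nonneg)
  ultimately show ?thesis by blast
qed

lemma sum_inverse_le_ln:
  assumes "(1::int) \<le> N"
  shows "(\<Sum>n=1..N. 1 / real_of_int n) \<le> 1 + ln (real_of_int N)"
  using assms
proof (induction N rule: int_ge_induct)
  case (step N)
  have "ln (real_of_int N / real_of_int (N + 1)) \<le> real_of_int N / real_of_int (N + 1) - 1"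
    using step.hyps by (intro ln_le_minus_one) auto
  then have "1 / real_of_int (N + 1) \<le> ln (real_of_int (N + 1)) - ln (real_of_int N)"
    using step.hyps by (simp add: ln_div field_simps)
  moreover have "{1..N + 1} = insert (N + 1) {1..N}" using step.hyps by auto
  ultimately show ?case using step.IH by simp
qed simp

lemma sum_inverse_ge_ln:
  assumes "(1::int) \<le> a" "a \<le> N"
  shows "ln (real_of_int (N + 1)) - ln (real_of_int a) \<le> (\<Sum>n=a..N. 1 / real_of_int n)"
proof -
  have ln_step: "ln (real_of_int (m + 1)) - ln (real_of_int m) \<le> 1 / real_of_int m" if "1 \<le> m" for m
  proof -
    have "ln (real_of_int (m + 1) / real_of_int m) \<le> real_of_int (m + 1) / real_of_int m - 1"
      using that by (intro ln_le_minus_one) auto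
    then show ?thesis using that by (simp add: ln_div field_simps)
  qed
  show ?thesis
    using assms(2)
  proof (induction N rule: int_ge_induct)
    case base
    then show ?case using ln_step[of a] assms(1) by simp
  next
    case (step N)
    have "{a..N + 1} = insert (N + 1) {a..N}" using step.hyps by auto
    then show ?case using step.IH ln_step[of "N + 1"] step.hyps assms(1) by simp
  qed
qed

section \<open>One step of the ground state substitution\<close>

lemma sum_int_atLeastAtMost_Suc:
  fixes a N :: int
  assumes "a \<le> N + 1"
  shows "sum f {a..N + 1} = sum f {a..N} + (f (N + 1) :: 'a::comm_monoid_add)"
proof -
  have "{a..N + 1} = insert (N + 1) {a..N}" using assms by auto
  then show ?thesis by (simp add: add.commute)
qed

text \<open>With \<open>x = p * a\<close> and \<open>y = q * b\<close> this is a polynomial identity. It compares the increment of a sequence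
with the increment of its quotient by a positive sequence with values \<open>p\<close> and \<open>q\<close>.\<close>
lemma square_difference_ground_state:
  fixes x y p q :: real
  assumes "p > 0" "q > 0"
  shows "(x - y)\<^sup>2 = (p - q) * (x\<^sup>2 / p - y\<^sup>2 / q) + q * p * (x / p - y / q)\<^sup>2"
proof -
  define a b where "a = x / p" and "b = y / q"
  have xy: "x = p * a" "y = q * b" using assms by (simp_all add: a_def b_def)
  have "(p * a - q * b)\<^sup>2 = (p - q) * (p * a\<^sup>2 - q * b\<^sup>2) + q * p * (a - b)\<^sup>2"
    by (simp add: power2_eq_square algebra_simps)
  then show ?thesis using assms by (simp add: xy power_mult_distrib power2_eq_square)
qed

lemma cmod_difference_ground_state:
  fixes x y :: complex and p q :: real
  assumes "p > 0" "q > 0"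
  shows "(cmod (x - y))\<^sup>2 = (p - q) * ((cmod x)\<^sup>2 / p - (cmod y)\<^sup>2 / q)
    + q * p * (cmod (x / of_real p - y / of_real q))\<^sup>2"
proof -
  have collect: "(r * (A - B) + t * C) + (r * (A' - B') + t * C') = r * (A + A' - (B + B')) + t * (C + C')"
    for r t A A' B B' C C' :: real by (simp add: algebra_simps)
  show ?thesis
    unfolding cmod_power2 minus_complex.simps Re_divide_of_real Im_divide_of_real add_divide_distrib
      square_difference_ground_state[OF assms, of "Re x" "Re y"]
      square_difference_ground_state[OF assms, of "Im x" "Im y"] collect ..
qed

text \<open>The pointwise identity above is summed against \<open>V\<close>, and the term with the flux \<open>F = V * dvg h\<close> is summed by
parts. The boundary term that remains at the cut \<open>N\<close> is nonnegative as soon as \<open>F N\<close> is; this is how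
sequences of infinite support are handled without any approximation argument.\<close>
lemma ground_state_summation:
  fixes h F V :: "int \<Rightarrow> real" and v :: "int \<Rightarrow> complex"
  assumes "a \<le> N" and "h a = 0" "v a = 0" and pos: "\<And>n. n > a \<Longrightarrow> h n > 0"
    and F: "\<And>n. n \<ge> a \<Longrightarrow> V n * (h (n + 1) - h n) = F n"
  shows "(\<Sum>n=a..N. V n * (cmod (v (n + 1) - v n))\<^sup>2) =
      (\<Sum>n=a+1..N. (F (n - 1) - F n) / h n * (cmod (v n))\<^sup>2)
    + (\<Sum>n=a+1..N. V n * h n * h (n + 1) *
        (cmod (v (n + 1) / of_real (h (n + 1)) - v n / of_real (h n)))\<^sup>2)
    + F N * (cmod (v (N + 1)))\<^sup>2 / h (N + 1)"
  using assms(1)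
proof (induction N rule: int_ge_induct)
  case base
  have "V a * h (a + 1) = F a" using F[of a] assms(2) by simp
  moreover have "h (a + 1) > 0" using pos by simp
  ultimately show ?case using assms(3) by (auto simp: field_simps)
next
  case (step N)
  have h: "h (N + 1 + 1) > 0" "h (N + 1) > 0" using pos step.hyps by auto
  have "V (N + 1) * (cmod (v (N + 1 + 1) - v (N + 1)))\<^sup>2
      = F (N + 1) * ((cmod (v (N + 1 + 1)))\<^sup>2 / h (N + 1 + 1) - (cmod (v (N + 1)))\<^sup>2 / h (N + 1))
      + V (N + 1) * h (N + 1) * h (N + 1 + 1) *
        (cmod (v (N + 1 + 1) / of_real (h (N + 1 + 1)) - v (N + 1) / of_real (h (N + 1))))\<^sup>2"
  proof -
    have "V (N + 1) * ((h (N + 1 + 1) - h (N + 1)) * X + h (N + 1) * h (N + 1 + 1) * Q)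
        = F (N + 1) * X + V (N + 1) * h (N + 1) * h (N + 1 + 1) * Q" for X Q
      using F[of "N + 1"] step.hyps by (simp add: distrib_left mult.assoc[symmetric])
    then show ?thesis by (subst cmod_difference_ground_state[OF h])
  qed
  moreover have "(F (N + 1 - 1) - F (N + 1)) / h (N + 1) * (cmod (v (N + 1)))\<^sup>2
      = F N * (cmod (v (N + 1)))\<^sup>2 / h (N + 1) - F (N + 1) * ((cmod (v (N + 1)))\<^sup>2 / h (N + 1))"
    by (simp add: diff_divide_distrib left_diff_distrib)
  moreover have "a \<le> N + 1" "a + 1 \<le> N + 1" using step.hyps by auto
  ultimately show ?case
    using step.IH by (simp only: sum_int_atLeastAtMost_Suc right_diff_distrib) simp
qed

section \<open>The chain of weighted Hardy identities\<close>

locale birman_ground_state =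
  fixes l :: nat and s :: real and g :: "int \<Rightarrow> real"
  assumes l_pos: "1 \<le> l"
    and g_in_H_space: "g \<in> H_space (int l)"
    and dvg_pos: "\<And>k n. k < l \<Longrightarrow> int l - int k \<le> n \<Longrightarrow> 0 < (dvg ^^ k) g n"
    and dvg_superharmonic: "\<And>k n. 1 \<le> k \<Longrightarrow> k < l \<Longrightarrow> int l + 1 - int k \<le> n \<Longrightarrow>
               0 \<le> (neg_lap ^^ (l - k)) ((dvg ^^ k) g) n"
    and superharmonic: "\<And>n. int l \<le> n \<Longrightarrow> 0 \<le> (neg_lap ^^ l) g n"
    and s_bounds: "0 < s" "s < 1"
    and expansion: "has_power_expansion l s g"
begin

abbreviation dg :: "nat \<Rightarrow> int \<Rightarrow> real" where "dg k \<equiv> (dvg ^^ k) g"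

text \<open>The case \<open>k = 0\<close> is the numerator of the weight \<open>rho\<close>, and the case \<open>k = l\<close> is \<open>dg l\<close>. For \<open>k < l\<close>,
\<open>flux (Suc k)\<close> is the flux of the ground state \<open>dg k\<close> in its weighted Hardy identity.\<close>
definition flux :: "nat \<Rightarrow> int \<Rightarrow> real" where
  "flux k = (neg_lap ^^ (l - k)) (dg k)"

text \<open>The weights that interpolate between \<open>rho\<close>, at \<open>k = 0\<close>, and the constant 1, at \<open>k = l\<close>. The last case
is set apart because \<open>dg l\<close> need not be positive everywhere.\<close>
definition weight :: "nat \<Rightarrow> int \<Rightarrow> real" where
  "weight k n = (if k = l then 1 else flux k n / dg k n)"

definition remainder :: "nat \<Rightarrow> (int \<Rightarrow> complex) \<Rightarrow> int \<Rightarrow> real" where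
  "remainder k u n = weight (Suc k) n * dg k n * dg k (n + 1) *
     (cmod ((dvg ^^ k) u (n + 1) / of_real (dg k (n + 1)) - (dvg ^^ k) u n / of_real (dg k n)))\<^sup>2"

definition energy :: "nat \<Rightarrow> int \<Rightarrow> (int \<Rightarrow> complex) \<Rightarrow> real" where
  "energy k N u = (\<Sum>n=int l - int k..N. weight k n * (cmod ((dvg ^^ k) u n))\<^sup>2)"

lemma flux_top: "flux l = dg l"
  by (simp add: flux_def)

lemma weight_mult_dg:
  assumes "k \<le> l" "int l - int k \<le> n"
  shows "weight k n * dg k n = flux k n"
  using assms dvg_pos[of k n] by (cases "k = l") (auto simp: weight_def flux_top)

lemma rho_eq_weight: "rho l g = weight 0"
  using l_pos by (auto simp: rho_def weight_def flux_def fun_eq_iff)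

lemma flux_eq_dvg:
  assumes "k \<le> l"
  shows "flux k n = (-1) ^ (l - k) * dg (2 * l - k) (n - int (l - k))"
proof -
  have "2 * (l - k) + k = 2 * l - k" using assms by simp
  then show ?thesis
    unfolding flux_def neg_lap_funpow by (simp only: dvg_funpow_funpow)
qed

text \<open>The adjoint of \<open>dvg\<close> is \<open>- nabla\<close>, and \<open>- nabla\<close> composed with \<open>dvg\<close> is \<open>neg_lap\<close>. So the weight
produced by one step is exactly the weight with which the next step starts.\<close>
lemma flux_step:
  assumes "k < l"
  shows "flux (Suc k) (n - 1) - flux (Suc k) n = flux k n"
proof -
  have "2 * l - k = Suc (2 * l - Suc k)" "l - k = Suc (l - Suc k)" using assms by auto
  then have "flux k n = (-1) ^ Suc (l - Suc k) * (dvg ^^ Suc (2 * l - Suc k)) g (n - 1 - int (l - Suc k))"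
    using flux_eq_dvg[of k n] assms by (simp add: algebra_simps del: funpow.simps)
  also have "\<dots> = flux (Suc k) (n - 1) - flux (Suc k) n"
    using assms by (simp only: flux_eq_dvg dvg_funpow_Suc) (simp add: flux_eq_dvg algebra_simps)
  finally show ?thesis by simp
qed

lemma flux_nonneg:
  assumes "k < l" "int l + 1 - int k \<le> n \<or> k = 0 \<and> int l \<le> n"
  shows "0 \<le> flux k n"
  using assms dvg_superharmonic[of k n] superharmonic[of n]
  by (cases "k = 0") (auto simp: flux_def)

lemma dg_eq_0: "n < int l - int k \<Longrightarrow> dg k n = 0"
  using dvg_funpow_in_H_space[OF g_in_H_space, of k] by (simp add: H_space_def)

lemma dvg_funpow_eq_0_of_H_space:
  fixes u :: "int \<Rightarrow> complex"
  assumes "u \<in> H_space (int l)" "n < int l - int k" shows "(dvg ^^ k) u n = 0"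
  using dvg_funpow_in_H_space[OF assms(1), of k] assms(2) by (simp add: H_space_def)

lemma energy_step:
  assumes "u \<in> H_space (int l)" "k < l" "int l \<le> N"
  shows "energy (Suc k) N u = energy k N u + (\<Sum>n=int l - int k..N. remainder k u n)
    + flux (Suc k) N * (cmod ((dvg ^^ k) u (N + 1)))\<^sup>2 / dg k (N + 1)"
proof -
  define a where "a = int l - int (Suc k)"
  have a: "a + 1 = int l - int k" "a \<le> N" using assms by (auto simp: a_def)
  have "energy (Suc k) N u
      = (\<Sum>n=a..N. weight (Suc k) n * (cmod ((dvg ^^ k) u (n + 1) - (dvg ^^ k) u n))\<^sup>2)"
    unfolding energy_def a_def dvg_funpow_Suc ..
  also have "\<dots> = (\<Sum>n=a+1..N. (flux (Suc k) (n - 1) - flux (Suc k) n) / dg k n * (cmod ((dvg ^^ k) u n))\<^sup>2)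
    + (\<Sum>n=a+1..N. weight (Suc k) n * dg k n * dg k (n + 1) *
        (cmod ((dvg ^^ k) u (n + 1) / of_real (dg k (n + 1)) - (dvg ^^ k) u n / of_real (dg k n)))\<^sup>2)
    + flux (Suc k) N * (cmod ((dvg ^^ k) u (N + 1)))\<^sup>2 / dg k (N + 1)"
  proof (rule ground_state_summation)
    show "dg k a = 0" "(dvg ^^ k) u a = 0"
      using dg_eq_0 dvg_funpow_eq_0_of_H_space[OF assms(1)] by (simp_all add: a_def)
    show "0 < dg k n" if "a < n" for n
      using that assms(2) by (intro dvg_pos) (auto simp: a_def)
    show "weight (Suc k) n * (dg k (n + 1) - dg k n) = flux (Suc k) n" if "a \<le> n" for n
      using weight_mult_dg[of "Suc k" n] that assms(2) by (simp only: dvg_funpow_Suc) (simp add: a_def)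
  qed (rule a)
  also have "(\<Sum>n=a+1..N. (flux (Suc k) (n - 1) - flux (Suc k) n) / dg k n * (cmod ((dvg ^^ k) u n))\<^sup>2)
      = energy k N u"
    using assms(2) unfolding energy_def a(1) by (simp add: flux_step weight_def)
  finally show ?thesis by (simp add: remainder_def a(1))
qed

text \<open>Telescoping over \<open>k\<close> splits the energy at level \<open>l\<close>, which is the left-hand side of the Birman
inequality cut at \<open>N\<close>, into the right-hand side, the remainders and the boundary terms.\<close>
lemma energy_expand:
  assumes "u \<in> H_space (int l)" "int l \<le> N"
  shows "energy l N u = energy 0 N u + (\<Sum>k<l. \<Sum>n=int l - int k..N. remainder k u n)
    + (\<Sum>k<l. flux (Suc k) N * (cmod ((dvg ^^ k) u (N + 1)))\<^sup>2 / dg k (N + 1))"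
proof -
  have "energy m N u = energy 0 N u + (\<Sum>k<m. \<Sum>n=int l - int k..N. remainder k u n)
    + (\<Sum>k<m. flux (Suc k) N * (cmod ((dvg ^^ k) u (N + 1)))\<^sup>2 / dg k (N + 1))" if "m \<le> l" for m
    using that
  proof (induction m)
    case (Suc m)
    then have m: "m < l" "m \<le> l" by auto
    show ?case
      unfolding energy_step[OF assms(1) m(1) assms(2)] Suc.IH[OF m(2)] sum.lessThan_Suc
      by (simp only: add_ac)
  qed simp
  from this[OF order_refl] show ?thesis .
qed

lemma energy_top: "energy l N u = (\<Sum>n=0..N. (cmod ((dvg ^^ l) u n))\<^sup>2)"
  by (simp add: energy_def weight_def)

lemma energy_0: "energy 0 N u = (\<Sum>n=int l..N. rho l g n * (cmod (u n))\<^sup>2)"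
  by (simp add: energy_def rho_eq_weight)

lemma weight_nonneg:
  assumes "k \<le> l" "0 < k" "int l + 1 - int k \<le> n"
  shows "0 \<le> weight k n"
  using assms flux_nonneg[of k n] dvg_pos[of k n] by (auto simp: weight_def)

lemma remainder_nonneg:
  assumes "k < l" "int l - int k \<le> n"
  shows "0 \<le> remainder k u n"
  unfolding remainder_def using assms dvg_pos[of k n] dvg_pos[of k "n + 1"] weight_nonneg[of "Suc k" n]
  by (intro mult_nonneg_nonneg) auto

lemma rho_nonneg: "int l \<le> n \<Longrightarrow> 0 \<le> rho l g n"
  using superharmonic[of n] dvg_pos[of 0 n] l_pos by (simp add: rho_def)

abbreviation "\<gamma> \<equiv> real l - s"

text \<open>The limits are nonzero because \<open>l - s\<close> is not an integer. Positivity of \<open>g\<close> fixes the sign of the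
leading coefficient; the factors \<open>l - s - i\<close> with \<open>i < l\<close> are positive.\<close>
lemma asymptotics:
  "\<exists>c. (\<forall>m\<le>2 * l. (\<lambda>n::nat. dg m (int n) / real n powr (\<gamma> - real m)) \<longlonglongrightarrow> c m)
    \<and> (\<forall>m. c m \<noteq> 0) \<and> (\<forall>k\<le>l. c k > 0)"
proof -
  from power_expansion_dvg_tendsto[OF expansion] obtain c0 where c0: "c0 \<noteq> 0" "\<forall>m\<le>2 * l.
      (\<lambda>n::nat. dg m (int n) / real n powr (\<gamma> - real m)) \<longlonglongrightarrow> c0 * (\<Prod>i<m. \<gamma> - real i)"
    by (elim exE conjE) (rule that)
  have "0 \<le> c0"
  proof (rule tendsto_lowerbound)
    show "(\<lambda>n::nat. g (int n) / real n powr \<gamma>) \<longlonglongrightarrow> c0" using c0(2)[rule_format, of 0] by simp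
    show "\<forall>\<^sub>F n in sequentially. 0 \<le> g (int n) / real n powr \<gamma>"
      using eventually_ge_at_top[of l]
      by eventually_elim (use dvg_pos[of 0] l_pos in \<open>auto intro!: divide_nonneg_nonneg less_imp_le\<close>)
  qed auto
  with c0(1) have "c0 > 0" by simp
  have nz: "\<gamma> - real i \<noteq> 0" for i
  proof
    assume "\<gamma> - real i = 0"
    then have "s = of_int (int l - int i)" by simp
    with s_bounds show False by (simp del: of_int_diff)
  qed
  show ?thesis
  proof (intro exI conjI allI impI)
    show "c0 * (\<Prod>i<m. \<gamma> - real i) \<noteq> 0" for m using c0(1) nz by simp
    show "c0 * (\<Prod>i<k. \<gamma> - real i) > 0" if "k \<le> l" for k
    proof (intro mult_pos_pos prod_pos ballI)
      fix i assume "i \<in> {..<k}"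
      then have "real i \<le> real l - 1" using that by auto
      with s_bounds show "0 < \<gamma> - real i" by linarith
    qed fact
  qed (rule c0(2)[rule_format])
qed

text \<open>Only the last flux, which is \<open>dg l\<close>, is not covered by the sign conditions on \<open>g\<close>; its sign near
infinity comes from the expansion.\<close>
lemma eventually_flux_nonneg:
  obtains N0 where "int l \<le> N0" "\<And>k n. k < l \<Longrightarrow> N0 \<le> n \<Longrightarrow> 0 \<le> flux (Suc k) n"
proof -
  from asymptotics obtain c where c: "\<forall>m\<le>2 * l. (\<lambda>n::nat. dg m (int n) / real n powr (\<gamma> - real m)) \<longlonglongrightarrow> c m"
    "\<forall>m. c m \<noteq> 0" "\<forall>k\<le>l. c k > 0"
    by (elim exE conjE) (rule that)
  from c(1)[rule_format, of l] c(3)[rule_format, of l]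
  have lim: "(\<lambda>n::nat. dg l (int n) / real n powr (\<gamma> - real l)) \<longlonglongrightarrow> c l" "c l > 0"
    by simp_all
  have "\<forall>\<^sub>F n in sequentially. dg l (int n) / real n powr (\<gamma> - real l) > 0"
    using order_tendstoD(1)[OF lim] .
  then obtain n0 where n0: "\<And>n. n \<ge> n0 \<Longrightarrow> dg l (int n) / real n powr (\<gamma> - real l) > 0"
    by (auto simp: eventually_sequentially)
  show ?thesis
  proof (rule that)
    show "0 \<le> flux (Suc k) n" if "k < l" "int (l + n0) \<le> n" for k n
    proof (cases "Suc k = l")
      case True
      have "n0 \<le> nat n" "n \<ge> 0" using that by auto
      then have "0 < dg l n" using n0[of "nat n"] by (simp add: zero_less_divide_iff)
      then show ?thesis using True flux_top by simp
    next
      case False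
      then show ?thesis using that by (intro flux_nonneg) auto
    qed
  qed auto
qed

section \<open>Size of the remainders along the cutoff ground state\<close>
lemma dg_bound:
  "\<exists>A>0. \<forall>m\<le>2*l. \<forall>i\<in>{- 2 * int l..2 * int l}. \<forall>n\<ge>1.
     \<bar>dg m (n + i)\<bar> \<le> A * real_of_int n powr (\<gamma> - real m)"
proof -
  from asymptotics obtain c where c: "\<forall>m\<le>2 * l. (\<lambda>n::nat. dg m (int n) / real n powr (\<gamma> - real m)) \<longlonglongrightarrow> c m"
    "\<forall>m. c m \<noteq> 0" "\<forall>k\<le>l. c k > 0"
    by (elim exE conjE) (rule that)
  have "\<exists>A>0. \<forall>p\<in>{..2*l} \<times> {- 2 * int l..2 * int l}. \<forall>n\<in>{1..}.
      \<bar>dg (fst p) (n + snd p)\<bar> \<le> A * real_of_int n powr (\<gamma> - real (fst p))"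
  proof (rule uniform_bound_finite)
    fix p assume "p \<in> {..2*l} \<times> {- 2 * int l..2 * int l}"
    then have "(\<lambda>n::nat. dg (fst p) (int n + snd p) / real n powr (\<gamma> - real (fst p))) \<longlonglongrightarrow> c (fst p)"
      by (intro tendsto_shift_powr c(1)[rule_format]) auto
    from powr_bound_of_tendsto[of "\<lambda>n. dg (fst p) (n + snd p)", OF this]
    show "\<exists>C. \<forall>n\<in>{1..}. \<bar>dg (fst p) (n + snd p)\<bar> \<le> C * real_of_int n powr (\<gamma> - real (fst p))"
      by auto
  qed auto
  then show ?thesis by fastforce
qed

lemma inverse_dg_bound:
  "\<exists>C>0. \<forall>k<l. \<forall>n\<ge>int l - int k. 1 / dg k n \<le> C * real_of_int n powr (- (\<gamma> - real k))"
proof -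
  from asymptotics obtain c where c: "\<forall>m\<le>2 * l. (\<lambda>n::nat. dg m (int n) / real n powr (\<gamma> - real m)) \<longlonglongrightarrow> c m"
    "\<forall>m. c m \<noteq> 0" "\<forall>k\<le>l. c k > 0"
    by (elim exE conjE) (rule that)
  have "\<exists>C>0. \<forall>k\<in>{..<l}. \<forall>n\<in>{int l - int k..}. 1 / dg k n \<le> C * real_of_int n powr (- (\<gamma> - real k))"
  proof (rule uniform_bound_finite)
    fix k assume k: "k \<in> {..<l}"
    then have "(\<lambda>n::nat. inverse (dg k (int n) / real n powr (\<gamma> - real k))) \<longlonglongrightarrow> inverse (c k)"
      by (intro tendsto_inverse c(1)[rule_format] c(2)[rule_format]) auto
    then have "(\<lambda>n::nat. 1 / dg k (int n) / real n powr (- (\<gamma> - real k))) \<longlonglongrightarrow> inverse (c k)"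
      by (simp only: powr_minus inverse_eq_divide divide_divide_eq_left divide_divide_eq_right mult_1_left mult_1_right)
         (simp add: field_simps)
    from powr_bound_of_tendsto[of "\<lambda>n. 1 / dg k n", OF this] obtain C where
      C: "\<And>n. 1 \<le> n \<Longrightarrow> \<bar>1 / dg k n\<bar> \<le> C * real_of_int n powr (- (\<gamma> - real k))" by blast
    show "\<exists>C. \<forall>n\<in>{int l - int k..}. 1 / dg k n \<le> C * real_of_int n powr (- (\<gamma> - real k))"
    proof (intro exI ballI)
      fix n assume "n \<in> {int l - int k..}"
      then have "1 \<le> n" using k by auto
      from C[OF this] show "1 / dg k n \<le> C * real_of_int n powr (- (\<gamma> - real k))"
        by (rule order_trans[OF abs_ge_self])
    qed
  qed auto
  then show ?thesis by auto
qed

lemma weight_bound: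
  "\<exists>W>0. \<forall>k<l. \<forall>n\<ge>int l - int k.
     weight (Suc k) n \<le> W * real_of_int n powr (- 2 * (real l - real k - 1))"
proof -
  obtain A where A: "A > 0" "\<And>m i n. m \<le> 2 * l \<Longrightarrow> i \<in> {- 2 * int l..2 * int l} \<Longrightarrow> 1 \<le> n \<Longrightarrow>
     \<bar>dg m (n + i)\<bar> \<le> A * real_of_int n powr (\<gamma> - real m)" using dg_bound by blast
  obtain C where C: "C > 0" "\<And>k n. k < l \<Longrightarrow> int l - int k \<le> n \<Longrightarrow>
     1 / dg k n \<le> C * real_of_int n powr (- (\<gamma> - real k))" using inverse_dg_bound by blast
  have "weight (Suc k) n \<le> (1 + A * C) * real_of_int n powr (- 2 * (real l - real k - 1))"
    if k: "k < l" and n: "int l - int k \<le> n" for k n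
  proof (cases "Suc k = l")
    case True
    then have "- 2 * (real l - real k - 1) = 0" by auto
    moreover have "1 \<le> n" using k n by auto
    ultimately show ?thesis using True A(1) C(1) by (simp only: weight_def) simp
  next
    case False
    define d where "d = l - Suc k"
    have n1: "1 \<le> n" using k n by auto
    have "\<bar>flux (Suc k) n\<bar> = \<bar>dg (2 * l - Suc k) (n + - int d)\<bar>"
      using k by (simp add: flux_eq_dvg abs_mult d_def[symmetric])
    also have "\<dots> \<le> A * real_of_int n powr (\<gamma> - real (2 * l - Suc k))"
      using n1 by (intro A(2)) (auto simp: d_def)
    finally have F: "flux (Suc k) n \<le> A * real_of_int n powr (\<gamma> - real (2 * l - Suc k))" by simp
    have pos: "0 < dg (Suc k) n" using False k n by (intro dvg_pos) auto
    have "weight (Suc k) n = flux (Suc k) n * (1 / dg (Suc k) n)" using False by (simp add: weight_def)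
    also have "\<dots> \<le> (A * real_of_int n powr (\<gamma> - real (2 * l - Suc k)))
        * (C * real_of_int n powr (- (\<gamma> - real (Suc k))))"
    proof (intro mult_mono F C(2))
      show "Suc k < l" "int l - int (Suc k) \<le> n" using False k n by auto
    qed (use A(1) pos in auto)
    also have "\<dots> = A * C * (real_of_int n powr (\<gamma> - real (2 * l - Suc k)) * real_of_int n powr (- (\<gamma> - real (Suc k))))"
      by (simp only: mult_ac)
    also have "real_of_int n powr (\<gamma> - real (2 * l - Suc k)) * real_of_int n powr (- (\<gamma> - real (Suc k)))
        = real_of_int n powr (- 2 * (real l - real k - 1))"
      using k by (simp add: powr_add[symmetric] of_nat_diff algebra_simps)
    also have "A * C * real_of_int n powr (- 2 * (real l - real k - 1))
        \<le> (1 + A * C) * real_of_int n powr (- 2 * (real l - real k - 1))"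
      by (intro mult_right_mono) auto
    finally show ?thesis .
  qed
  moreover have "1 + A * C > 0" using A(1) C(1) by (simp add: add_pos_pos)
  ultimately show ?thesis by blast
qed

text \<open>Up to weights, the remainder is the square of a discrete Wronskian of \<open>(dvg ^^ k) x\<close> and \<open>dg k\<close>. In this form the
denominators no longer have to be differenced.\<close>
lemma remainder_of_real:
  assumes "k < l" "int l - int k \<le> n"
  shows "remainder k (\<lambda>n. of_real (x n)) n = weight (Suc k) n * (1 / dg k n) * (1 / dg k (n + 1)) *
    ((dvg ^^ Suc k) x n * dg k n - (dvg ^^ k) x n * dg (Suc k) n)\<^sup>2"
proof -
  have pos: "0 < dg k n" "0 < dg k (n + 1)" using assms by (auto intro!: dvg_pos)
  let ?y = "(dvg ^^ k) x"
  have "cmod ((dvg ^^ k) (\<lambda>n. of_real (x n)) (n + 1) / of_real (dg k (n + 1))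
      - (dvg ^^ k) (\<lambda>n. of_real (x n)) n / of_real (dg k n)) = \<bar>?y (n + 1) / dg k (n + 1) - ?y n / dg k n\<bar>"
    unfolding dvg_funpow_of_real of_real_divide[symmetric] of_real_diff[symmetric] norm_of_real ..
  also have "?y (n + 1) / dg k (n + 1) - ?y n / dg k n
      = ((dvg ^^ Suc k) x n * dg k n - ?y n * dg (Suc k) n) * ((1 / dg k n) * (1 / dg k (n + 1)))"
    unfolding dvg_funpow_Suc using pos by (simp add: field_simps)
  finally show ?thesis
    unfolding remainder_def using pos by (simp add: power_mult_distrib power2_eq_square del: funpow.simps)
qed

text \<open>For \<open>x = log_cutoff l N * g\<close> the Leibniz terms in which the cutoff is not differenced add up to
\<open>log_cutoff l N n * (dg (Suc k) n * dg k n - dg k n * dg (Suc k) n) = 0\<close>. All surviving terms carry the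
factor \<open>1 / ln N\<close>.\<close>
lemma wronskian_bound:
  "\<exists>K>0. \<forall>N\<ge>3. \<forall>k<l. \<forall>n\<ge>1.
     \<bar>(dvg ^^ Suc k) (\<lambda>n. log_cutoff l N n * g n) n * dg k n
       - (dvg ^^ k) (\<lambda>n. log_cutoff l N n * g n) n * dg (Suc k) n\<bar>
     \<le> K / ln (real_of_int N) * real_of_int n powr (2 * \<gamma> - 2 * real k - 1)"
proof -
  obtain A where A: "A > 0" "\<And>m i n. m \<le> 2 * l \<Longrightarrow> i \<in> {- 2 * int l..2 * int l} \<Longrightarrow> 1 \<le> n \<Longrightarrow>
     \<bar>dg m (n + i)\<bar> \<le> A * real_of_int n powr (\<gamma> - real m)" using dg_bound by blast
  have A0: "\<bar>dg m n\<bar> \<le> A * real_of_int n powr (\<gamma> - real m)" if "m \<le> 2 * l" "1 \<le> n" for m n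
    using A(2)[of m 0 n] that by simp
  obtain B where B: "B > 0" "\<And>N n i. 3 \<le> N \<Longrightarrow> 1 \<le> n \<Longrightarrow> 1 \<le> i \<Longrightarrow> i \<le> l \<Longrightarrow>
     \<bar>(dvg ^^ i) (log_cutoff l N) n\<bar> \<le> B * real_of_int n powr (- real i) / ln (real_of_int N)"
    using dvg_log_cutoff_bound[of l] by blast
  define K where "K = 2 ^ (l + 1) * (A * A * B)"
  have "\<bar>(dvg ^^ Suc k) (\<lambda>n. log_cutoff l N n * g n) n * dg k n
       - (dvg ^^ k) (\<lambda>n. log_cutoff l N n * g n) n * dg (Suc k) n\<bar>
     \<le> K / ln (real_of_int N) * real_of_int n powr (2 * \<gamma> - 2 * real k - 1)"
    if N: "3 \<le> N" and k: "k < l" and n: "1 \<le> n" for N k n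
  proof -
    let ?x = "log_cutoff l N"
    have L: "1 \<le> ln (real_of_int N)" by (rule ln_ge_1[OF N])
    define b where "b = A * A * B / ln (real_of_int N) * real_of_int n powr (2 * \<gamma> - 2 * real k - 1)"
    have b: "0 \<le> b" using A(1) B(1) L by (simp add: b_def)
    have single: "\<bar>real (m choose i) * (dvg ^^ i) ?x n * dg (m - i) (n + int i) * dg p n\<bar> \<le> real (m choose i) * b"
      if "1 \<le> i" "i \<le> m" "m + p = Suc (2 * k)" "m \<le> Suc k" "p \<le> Suc k" for m i p
    proof -
      have "\<bar>(dvg ^^ i) ?x n\<bar> * \<bar>dg (m - i) (n + int i)\<bar> * \<bar>dg p n\<bar>
        \<le> (B * real_of_int n powr (- real i) / ln (real_of_int N))
          * (A * real_of_int n powr (\<gamma> - real (m - i))) * (A * real_of_int n powr (\<gamma> - real p))"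
        using that k n N A(1) B(1) L
        by (intro mult_mono B(2) A(2) A0 mult_nonneg_nonneg divide_nonneg_nonneg) auto
      also have "\<dots> = A * A * B / ln (real_of_int N) * (real_of_int n powr (- real i)
          * real_of_int n powr (\<gamma> - real (m - i)) * real_of_int n powr (\<gamma> - real p))"
        by (simp add: field_simps)
      also have "real_of_int n powr (- real i) * real_of_int n powr (\<gamma> - real (m - i)) * real_of_int n powr (\<gamma> - real p)
          = real_of_int n powr (2 * \<gamma> - 2 * real k - 1)"
      proof -
        have "real m + real p = 2 * real k + 1" using that(3) by linarith
        then have "- real i + (\<gamma> - real (m - i)) + (\<gamma> - real p) = 2 * \<gamma> - 2 * real k - 1"
          using that(2) by (simp add: of_nat_diff)
        then show ?thesis by (simp only: powr_add[symmetric])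
      qed
      also have "A * A * B / ln (real_of_int N) * real_of_int n powr (2 * \<gamma> - 2 * real k - 1) = b"
        by (simp only: b_def)
      finally have "real (m choose i) * (\<bar>(dvg ^^ i) ?x n\<bar> * \<bar>dg (m - i) (n + int i)\<bar> * \<bar>dg p n\<bar>)
          \<le> real (m choose i) * b"
        by (intro mult_left_mono) auto
      then show ?thesis by (simp only: abs_mult abs_of_nat mult.assoc)
    qed
    have expand: "(dvg ^^ m) (\<lambda>n. ?x n * g n) n * dg p n = ?x n * dg m n * dg p n
        + (\<Sum>i=1..m. real (m choose i) * (dvg ^^ i) ?x n * dg (m - i) (n + int i) * dg p n)" for m p
      unfolding dvg_funpow_mult
      by (simp add: atMost_atLeast0 sum.atLeast_Suc_atMost distrib_right sum_distrib_right)
    have part: "\<bar>\<Sum>i=1..m. real (m choose i) * (dvg ^^ i) ?x n * dg (m - i) (n + int i) * dg p n\<bar> \<le> 2 ^ l * b"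
      if "m + p = Suc (2 * k)" "m \<le> Suc k" "p \<le> Suc k" for m p
    proof -
      have "\<bar>\<Sum>i=1..m. real (m choose i) * (dvg ^^ i) ?x n * dg (m - i) (n + int i) * dg p n\<bar>
          \<le> (\<Sum>i=1..m. real (m choose i) * b)"
        using single that by (intro order_trans[OF sum_abs] sum_mono) auto
      also have "\<dots> \<le> (\<Sum>i\<le>m. real (m choose i) * b)"
        using b by (intro sum_mono2) auto
      also have "\<dots> = 2 ^ m * b"
        by (simp add: sum_distrib_right[symmetric] choose_row_sum of_nat_sum[symmetric] del: of_nat_sum)
      also have "\<dots> \<le> 2 ^ l * b"
        using that k b by (intro mult_right_mono power_increasing) auto
      finally show ?thesis .
    qed
    have "\<bar>(dvg ^^ Suc k) (\<lambda>n. ?x n * g n) n * dg k n - (dvg ^^ k) (\<lambda>n. ?x n * g n) n * dg (Suc k) n\<bar>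
        \<le> 2 ^ l * b + 2 ^ l * b"
      unfolding expand using part[of "Suc k" k] part[of k "Suc k"] by (simp del: funpow.simps add: mult_ac)
    also have "\<dots> = K / ln (real_of_int N) * real_of_int n powr (2 * \<gamma> - 2 * real k - 1)"
      by (simp add: K_def b_def)
    finally show ?thesis .
  qed
  moreover have "K > 0" using A(1) B(1) by (simp add: K_def)
  ultimately show ?thesis by blast
qed

text \<open>The powers of \<open>n\<close> coming from the weight, from the two denominators and from the squared Wronskian
combine to \<open>n powr (- 2 * s)\<close>, for every \<open>k\<close>.\<close>
lemma remainder_cutoff_bound:
  "\<exists>K>0. \<forall>N\<ge>3. \<forall>k<l. \<forall>n\<ge>int l - int k.
     remainder k (\<lambda>n. of_real (log_cutoff l N n * g n)) n \<le> K / (ln (real_of_int N))\<^sup>2 * real_of_int n powr (- 2 * s)"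
proof -
  obtain C where C: "C > 0" "\<And>k n. k < l \<Longrightarrow> int l - int k \<le> n \<Longrightarrow>
     1 / dg k n \<le> C * real_of_int n powr (- (\<gamma> - real k))" using inverse_dg_bound by blast
  obtain W where W: "W > 0" "\<And>k n. k < l \<Longrightarrow> int l - int k \<le> n \<Longrightarrow>
     weight (Suc k) n \<le> W * real_of_int n powr (- 2 * (real l - real k - 1))" using weight_bound by blast
  obtain K where K: "K > 0" "\<And>N k n. 3 \<le> N \<Longrightarrow> k < l \<Longrightarrow> 1 \<le> n \<Longrightarrow>
     \<bar>(dvg ^^ Suc k) (\<lambda>n. log_cutoff l N n * g n) n * dg k n
       - (dvg ^^ k) (\<lambda>n. log_cutoff l N n * g n) n * dg (Suc k) n\<bar>
     \<le> K / ln (real_of_int N) * real_of_int n powr (2 * \<gamma> - 2 * real k - 1)"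
    using wronskian_bound by blast
  have "remainder k (\<lambda>n. of_real (log_cutoff l N n * g n)) n
      \<le> W * C * C * K\<^sup>2 / (ln (real_of_int N))\<^sup>2 * real_of_int n powr (- 2 * s)"
    if N: "3 \<le> N" and k: "k < l" and n: "int l - int k \<le> n" for N k n
  proof -
    have n1: "1 \<le> n" using k n by auto
    have L: "1 \<le> ln (real_of_int N)" by (rule ln_ge_1[OF N])
    have pos: "0 < dg k n" "0 < dg k (n + 1)" using k n by (auto intro!: dvg_pos)
    have "1 / dg k (n + 1) \<le> C * real_of_int (n + 1) powr (- (\<gamma> - real k))"
      using k n by (intro C(2)) auto
    also have "\<dots> \<le> C * real_of_int n powr (- (\<gamma> - real k))"
    proof (intro mult_left_mono powr_mono2')
      have "real k + 1 \<le> real l" using k by linarith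
      then show "- (\<gamma> - real k) \<le> 0" using s_bounds by linarith
    qed (use n1 C(1) in auto)
    finally have C': "1 / dg k (n + 1) \<le> C * real_of_int n powr (- (\<gamma> - real k))" .
    let ?E = "(dvg ^^ Suc k) (\<lambda>n. log_cutoff l N n * g n) n * dg k n
       - (dvg ^^ k) (\<lambda>n. log_cutoff l N n * g n) n * dg (Suc k) n"
    have "?E\<^sup>2 = \<bar>?E\<bar>\<^sup>2" by simp
    also have "\<dots> \<le> (K / ln (real_of_int N) * real_of_int n powr (2 * \<gamma> - 2 * real k - 1))\<^sup>2"
      by (intro power_mono K(2) N k n1) simp
    finally have E: "?E\<^sup>2 \<le> (K / ln (real_of_int N) * real_of_int n powr (2 * \<gamma> - 2 * real k - 1))\<^sup>2" .
    have "remainder k (\<lambda>n. of_real (log_cutoff l N n * g n)) n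
        = weight (Suc k) n * (1 / dg k n) * (1 / dg k (n + 1)) * ?E\<^sup>2"
      by (rule remainder_of_real[OF k n])
    also have "\<dots> \<le> (W * real_of_int n powr (- 2 * (real l - real k - 1)))
        * (C * real_of_int n powr (- (\<gamma> - real k))) * (C * real_of_int n powr (- (\<gamma> - real k)))
        * (K / ln (real_of_int N) * real_of_int n powr (2 * \<gamma> - 2 * real k - 1))\<^sup>2"
      using pos W(1) C(1) K(1) by (intro mult_mono W(2) C(2) C' E k n mult_nonneg_nonneg) auto
    also have "\<dots> = W * C * C * K\<^sup>2 / (ln (real_of_int N))\<^sup>2 * (real_of_int n powr (- 2 * (real l - real k - 1))
        * real_of_int n powr (- (\<gamma> - real k)) * real_of_int n powr (- (\<gamma> - real k))
        * real_of_int n powr (2 * \<gamma> - 2 * real k - 1) * real_of_int n powr (2 * \<gamma> - 2 * real k - 1))"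
      by (simp add: power2_eq_square field_simps)
    also have "real_of_int n powr (- 2 * (real l - real k - 1))
        * real_of_int n powr (- (\<gamma> - real k)) * real_of_int n powr (- (\<gamma> - real k))
        * real_of_int n powr (2 * \<gamma> - 2 * real k - 1) * real_of_int n powr (2 * \<gamma> - 2 * real k - 1)
        = real_of_int n powr (- 2 * s)"
    proof -
      have "- 2 * (real l - real k - 1) + (- (\<gamma> - real k)) + (- (\<gamma> - real k))
        + (2 * \<gamma> - 2 * real k - 1) + (2 * \<gamma> - 2 * real k - 1) = - 2 * s" by argo
      then show ?thesis by (simp only: powr_add[symmetric])
    qed
    finally show ?thesis .
  qed
  moreover have "W * C * C * K\<^sup>2 > 0" using W(1) C(1) K(1) by simp
  ultimately show ?thesis by blast
qed

end

section \<open>The two sides as sums over an interval\<close>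

text \<open>Up to sign, the half-integer power is a shift of the difference of order \<open>l\<close>. The shift moves the
lower summation limit to 0, where the differences of elements of \<open>H_space l\<close> start.\<close>
lemma cmod_neg_lap_half:
  "cmod (neg_lap_half l u n) = cmod ((dvg ^^ l) u (n - \<lceil>real l / 2\<rceil>))"
proof (cases "even l")
  case True
  then obtain m where m: "l = 2 * m" by blast
  then have "\<lceil>real l / 2\<rceil> = int m" by simp
  then show ?thesis
    using m by (simp add: neg_lap_half_def neg_lap_funpow norm_mult norm_power)
next
  case False
  then obtain m where m: "l = 2 * m + 1" by (elim oddE)
  then have c: "\<lceil>real l / 2\<rceil> = int m + 1" by (simp add: ceiling_eq_iff)
  have "neg_lap_half l u n = (-1) ^ m * ((dvg ^^ (2 * m)) u (n - int m) - (dvg ^^ (2 * m)) u (n - 1 - int m))"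
    using m by (simp add: neg_lap_half_def nabla_def neg_lap_funpow algebra_simps)
  also have "\<dots> = (-1) ^ m * (dvg ^^ Suc (2 * m)) u (n - (int m + 1))"
    unfolding dvg_funpow_Suc by (simp add: algebra_simps)
  finally show ?thesis using m c by (simp add: norm_mult norm_power del: funpow.simps)
qed

lemma birman_lhs_eq: "birman_lhs l u = (\<Sum>\<^sub>\<infinity>n\<in>{0..}. ennreal ((cmod ((dvg ^^ l) u n))\<^sup>2))"
proof -
  let ?c = "\<lceil>real l / 2\<rceil>"
  have "bij_betw (\<lambda>n. n - ?c) {?c..} {0..}"
    by (rule bij_betwI[where g = "\<lambda>n. n + ?c"]) auto
  from infsum_reindex_bij_betw[OF this, of "\<lambda>n. ennreal ((cmod ((dvg ^^ l) u n))\<^sup>2)"]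
  show ?thesis unfolding birman_lhs_def cmod_neg_lap_half .
qed

lemma infsum_ennreal_eventually_zero:
  fixes f :: "int \<Rightarrow> real"
  assumes "\<And>n. n \<ge> a \<Longrightarrow> 0 \<le> f n" "\<And>n. n > N \<Longrightarrow> f n = 0"
  shows "(\<Sum>\<^sub>\<infinity>n\<in>{a..}. ennreal (f n)) = ennreal (\<Sum>n=a..N. f n)"
proof -
  have "(\<Sum>\<^sub>\<infinity>n\<in>{a..}. ennreal (f n)) = (\<Sum>\<^sub>\<infinity>n\<in>{a..N}. ennreal (f n))"
    using assms(2) by (intro infsum_cong_neutral) auto
  also have "\<dots> = ennreal (\<Sum>n=a..N. f n)"
    by (subst infsum_finite) (auto intro!: sum_ennreal assms(1))
  finally show ?thesis .
qed

lemma birman_lhs_finite: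
  assumes "\<And>n. n > N \<Longrightarrow> u n = 0"
  shows "birman_lhs l u = ennreal (\<Sum>n=0..N. (cmod ((dvg ^^ l) u n))\<^sup>2)"
  unfolding birman_lhs_eq
  by (rule infsum_ennreal_eventually_zero) (use assms in \<open>auto intro!: dvg_funpow_eq_0\<close>)

lemma birman_rhs_finite:
  assumes "\<And>n. n > N \<Longrightarrow> u n = 0" "\<And>n. n \<ge> int l \<Longrightarrow> 0 \<le> \<rho> n"
  shows "birman_rhs l \<rho> u = ennreal (\<Sum>n=int l..N. \<rho> n * (cmod (u n))\<^sup>2)"
  unfolding birman_rhs_def
  by (rule infsum_ennreal_eventually_zero) (use assms in auto)

lemma infsum_ennreal_of_summable:
  fixes f :: "'a \<Rightarrow> real"
  assumes "f summable_on A" "\<And>x. x \<in> A \<Longrightarrow> 0 \<le> f x"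
  shows "infsum (\<lambda>x. ennreal (f x)) A = ennreal (infsum f A)"
proof -
  have "infsum (\<lambda>x. ennreal (f x)) A = (SUP F\<in>{F. finite F \<and> F \<subseteq> A}. sum (\<lambda>x. ennreal (f x)) F)"
    by (rule nonneg_infsum_complete) simp
  also have "\<dots> = (SUP F\<in>{F. finite F \<and> F \<subseteq> A}. ennreal (sum f F))"
    using assms(2) by (intro SUP_cong refl sum_ennreal) auto
  also have "\<dots> = ennreal (infsum f A)"
    using infsum_nonneg_is_SUPREMUM_ennreal[OF assms] by simp
  finally show ?thesis .
qed

lemma cmod_parallelogram: "(cmod (x - y))\<^sup>2 + (cmod (x + y))\<^sup>2 = 2 * (cmod x)\<^sup>2 + 2 * (cmod y)\<^sup>2"
  unfolding cmod_power2 by (simp add: power2_eq_square algebra_simps)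

lemma H0_space_bound:
  assumes "u \<in> H0_space l" shows "\<exists>N\<ge>M. \<forall>n>N. u n = 0"
proof -
  from assms have "finite (insert M {n. u n \<noteq> 0})" by (simp add: H0_space_def)
  then have "bdd_above (insert M {n. u n \<noteq> 0})" by (rule bdd_above_finite)
  then obtain N where "\<And>n. n \<in> insert M {n. u n \<noteq> 0} \<Longrightarrow> n \<le> N" by (auto simp: bdd_above_def)
  then show ?thesis by (intro exI[of _ N]) force
qed

section \<open>The inequality and criticality\<close>

context birman_ground_state
begin

definition deficit :: "int \<Rightarrow> (int \<Rightarrow> complex) \<Rightarrow> real" where
  "deficit N u = energy l N u - energy 0 N u"

lemma deficit_finite:
  assumes "u \<in> H_space (int l)" "int l \<le> N" "\<And>n. n > N \<Longrightarrow> u n = 0"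
  shows "deficit N u = (\<Sum>k<l. \<Sum>n=int l - int k..N. remainder k u n)"
proof -
  have "(dvg ^^ k) u (N + 1) = 0" for k using assms(3) by (intro dvg_funpow_eq_0) auto
  then show ?thesis using energy_expand[OF assms(1,2)] by (simp add: deficit_def)
qed

text \<open>The boundary terms have the good sign as soon as the fluxes at \<open>N\<close> have, so this bound also reaches
sequences of infinite support.\<close>
lemma deficit_ge_remainder:
  assumes "u \<in> H_space (int l)" "int l \<le> N" and flux: "\<And>k. k < l \<Longrightarrow> 0 \<le> flux (Suc k) N"
    and m: "int l \<le> m" "m \<le> N"
  shows "remainder 0 u m \<le> deficit N u"
proof -
  have "remainder 0 u m \<le> (\<Sum>n=int l - int 0..N. remainder 0 u n)"
    using m l_pos by (intro member_le_sum remainder_nonneg) auto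
  also have "\<dots> \<le> (\<Sum>k<l. \<Sum>n=int l - int k..N. remainder k u n)"
    using l_pos by (intro member_le_sum[of 0 "{..<l}" "\<lambda>k. \<Sum>n=int l - int k..N. remainder k u n"])
      (auto intro!: sum_nonneg remainder_nonneg)
  also have "\<dots> \<le> (\<Sum>k<l. \<Sum>n=int l - int k..N. remainder k u n)
    + (\<Sum>k<l. flux (Suc k) N * (cmod ((dvg ^^ k) u (N + 1)))\<^sup>2 / dg k (N + 1))"
  proof -
    have "0 \<le> flux (Suc k) N * (cmod ((dvg ^^ k) u (N + 1)))\<^sup>2 / dg k (N + 1)" if "k < l" for k
      using flux[OF that] dvg_pos[OF that, of "N + 1"] assms(2) by simp
    then have "0 \<le> (\<Sum>k<l. flux (Suc k) N * (cmod ((dvg ^^ k) u (N + 1)))\<^sup>2 / dg k (N + 1))"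
      by (intro sum_nonneg) auto
    then show ?thesis by linarith
  qed
  also have "\<dots> = deficit N u" using energy_expand[OF assms(1,2)] by (simp add: deficit_def)
  finally show ?thesis .
qed

lemma deficit_nonneg:
  assumes "u \<in> H_space (int l)" "int l \<le> N" "\<And>n. n > N \<Longrightarrow> u n = 0"
  shows "0 \<le> deficit N u"
proof -
  have "deficit N u = (\<Sum>k<l. \<Sum>n=int l - int k..N. remainder k u n)"
    using assms by (rule deficit_finite)
  then show ?thesis by (auto intro!: sum_nonneg remainder_nonneg)
qed

lemma lhs_eq_energy: "(\<And>n. n > N \<Longrightarrow> u n = 0) \<Longrightarrow> birman_lhs l u = ennreal (energy l N u)"
  by (simp add: birman_lhs_finite energy_top)

lemma rhs_eq_energy: "(\<And>n. n > N \<Longrightarrow> u n = 0) \<Longrightarrow> birman_rhs l (rho l g) u = ennreal (energy 0 N u)"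
  using birman_rhs_finite[of N u l "rho l g"] rho_nonneg by (simp add: energy_0)

lemma hrb_weight_rho: "hrb_weight l (rho l g)"
  unfolding hrb_weight_def
proof (intro conjI ballI allI impI)
  fix u :: "int \<Rightarrow> complex" assume u: "u \<in> H0_space (int l)"
  then obtain N where N: "int l \<le> N" "\<And>n. n > N \<Longrightarrow> u n = 0"
    using H0_space_bound[of u "int l" "int l"] by blast
  have "u \<in> H_space (int l)" using u by (simp add: H0_space_def)
  then have "0 \<le> deficit N u" using N by (intro deficit_nonneg)
  then show "birman_rhs l (rho l g) u \<le> birman_lhs l u"
    using N(2) by (simp add: lhs_eq_energy[OF N(2)] rhs_eq_energy[OF N(2)] deficit_def ennreal_leI)
qed (rule rho_nonneg)

abbreviation trial :: "int \<Rightarrow> int \<Rightarrow> complex" where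
  "trial N \<equiv> (\<lambda>n. of_real (log_cutoff l N n * g n))"

lemma g_eq_0: "n < int l \<Longrightarrow> g n = 0"
  using g_in_H_space by (simp add: H_space_def)

lemma trial_support:
  assumes "3 \<le> N" shows "trial N \<in> H_space (int l)" "\<And>n. n > N \<Longrightarrow> trial N n = 0"
  using assms g_eq_0 l_pos log_cutoff_eq_0[of N] by (auto simp: H_space_def)

text \<open>For \<open>s \<ge> 1/2\<close> the remainders are at most of size \<open>1 / (n * (ln N)\<^sup>2)\<close>, and the harmonic sum up to \<open>N\<close>
costs back only one factor \<open>ln N\<close>.\<close>
lemma deficit_trial_bound:
  assumes "1/2 \<le> s"
  shows "\<exists>K>0. \<forall>N\<ge>max 3 (int l). deficit N (trial N) \<le> K / ln (real_of_int N)"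
proof -
  obtain K where K: "K > 0" "\<And>N k n. 3 \<le> N \<Longrightarrow> k < l \<Longrightarrow> int l - int k \<le> n \<Longrightarrow>
     remainder k (trial N) n \<le> K / (ln (real_of_int N))\<^sup>2 * real_of_int n powr (- 2 * s)"
    using remainder_cutoff_bound by blast
  have "deficit N (trial N) \<le> real l * K * 2 / ln (real_of_int N)" if "max 3 (int l) \<le> N" for N
  proof -
    have N: "3 \<le> N" "int l \<le> N" using that by auto
    have L: "1 \<le> ln (real_of_int N)" by (rule ln_ge_1[OF N(1)])
    have remainder_le: "remainder k (trial N) n \<le> K / (ln (real_of_int N))\<^sup>2 * (1 / real_of_int n)"
      if k: "k < l" and n: "int l - int k \<le> n" for k n
    proof -
      have "1 \<le> n" using k n by auto
      then have "real_of_int n powr (- 2 * s) \<le> real_of_int n powr (- 1)"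
        using assms by (intro powr_mono) auto
      also have "\<dots> = 1 / real_of_int n" using \<open>1 \<le> n\<close> by (simp add: powr_minus divide_simps)
      finally have "K / (ln (real_of_int N))\<^sup>2 * real_of_int n powr (- 2 * s)
          \<le> K / (ln (real_of_int N))\<^sup>2 * (1 / real_of_int n)"
        using K(1) by (intro mult_left_mono) auto
      with K(2)[OF N(1) k n] show ?thesis by linarith
    qed
    have "deficit N (trial N) = (\<Sum>k<l. \<Sum>n=int l - int k..N. remainder k (trial N) n)"
      using N trial_support[OF N(1)] by (intro deficit_finite)
    also have "\<dots> \<le> (\<Sum>k<l. \<Sum>n=int l - int k..N. K / (ln (real_of_int N))\<^sup>2 * (1 / real_of_int n))"
      using remainder_le by (intro sum_mono) auto
    also have "\<dots> \<le> (\<Sum>k<l. \<Sum>n=1..N. K / (ln (real_of_int N))\<^sup>2 * (1 / real_of_int n))"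
      using K(1) by (intro sum_mono sum_mono2) auto
    also have "\<dots> = real l * (K / (ln (real_of_int N))\<^sup>2 * (\<Sum>n=1..N. 1 / real_of_int n))"
      by (simp add: sum_distrib_left)
    also have "\<dots> \<le> real l * (K / (ln (real_of_int N))\<^sup>2 * (2 * ln (real_of_int N)))"
    proof (intro mult_left_mono)
      have "(\<Sum>n=1..N. 1 / real_of_int n) \<le> 1 + ln (real_of_int N)"
        using N(1) by (intro sum_inverse_le_ln) auto
      then show "(\<Sum>n=1..N. 1 / real_of_int n) \<le> 2 * ln (real_of_int N)" using L by linarith
    qed (use K(1) in auto)
    also have "\<dots> = real l * K * 2 / ln (real_of_int N)"
      using L by (simp add: power2_eq_square field_simps)
    finally show ?thesis .
  qed
  moreover have "real l * K * 2 > 0" using K(1) l_pos by simp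
  ultimately show ?thesis by blast
qed

text \<open>The cutoff ground states tend to \<open>g\<close> pointwise and their deficit tends to 0. A larger weight would
leave a positive amount \<open>(\<rho>' m - rho l g m) * (g m)\<^sup>2\<close> of the deficit.\<close>
lemma critical:
  assumes "1/2 \<le> s"
  shows "critical_weight l (rho l g)"
  unfolding critical_weight_def
proof (intro conjI hrb_weight_rho allI impI)
  fix \<rho>' m
  assume "hrb_weight l \<rho>' \<and> (\<forall>n\<ge>int l. rho l g n \<le> \<rho>' n)" and m: "int l \<le> m"
  then have \<rho>': "hrb_weight l \<rho>'" and ge: "\<And>n. int l \<le> n \<Longrightarrow> rho l g n \<le> \<rho>' n" by auto
  have nonneg: "\<And>n. int l \<le> n \<Longrightarrow> 0 \<le> \<rho>' n" using \<rho>' by (simp add: hrb_weight_def)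
  obtain K where K: "K > 0"
    "\<And>N. max 3 (int l) \<le> N \<Longrightarrow> deficit N (trial N) \<le> K / ln (real_of_int N)"
    using deficit_trial_bound[OF assms] by blast
  have bound: "(\<rho>' m - rho l g m) * (log_cutoff l N m * g m)\<^sup>2 \<le> K / ln (real_of_int N)"
    if "max 3 m \<le> N" for N
  proof -
    have N: "3 \<le> N" "int l \<le> N" "m \<le> N" using that m by auto
    have zero: "\<And>n. n > N \<Longrightarrow> trial N n = 0" using trial_support[OF N(1)] by blast
    have "{n. trial N n \<noteq> 0} \<subseteq> {int l..N}"
      using trial_support[OF N(1)] by (force simp: H_space_def not_less[symmetric])
    then have "trial N \<in> H0_space (int l)"
      using trial_support(1)[OF N(1)] finite_subset by (auto simp: H0_space_def)
    then have "birman_rhs l \<rho>' (trial N) \<le> birman_lhs l (trial N)"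
      using \<rho>' by (simp add: hrb_weight_def)
    then have "ennreal (\<Sum>n=int l..N. \<rho>' n * (cmod (trial N n))\<^sup>2) \<le> ennreal (energy l N (trial N))"
      by (simp only: lhs_eq_energy[OF zero] birman_rhs_finite[OF zero nonneg])
    moreover have "0 \<le> energy l N (trial N)" by (simp add: energy_top sum_nonneg)
    ultimately have "(\<Sum>n=int l..N. \<rho>' n * (cmod (trial N n))\<^sup>2) \<le> energy l N (trial N)"
      by (simp only: ennreal_le_iff)
    then have "(\<Sum>n=int l..N. (\<rho>' n - rho l g n) * (cmod (trial N n))\<^sup>2) \<le> deficit N (trial N)"
      by (simp add: deficit_def energy_0 left_diff_distrib sum_subtractf)
    moreover have "(\<rho>' m - rho l g m) * (cmod (trial N m))\<^sup>2
        \<le> (\<Sum>n=int l..N. (\<rho>' n - rho l g n) * (cmod (trial N n))\<^sup>2)"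
      using m N ge by (intro member_le_sum) auto
    moreover have "deficit N (trial N) \<le> K / ln (real_of_int N)" using N by (intro K(2)) auto
    ultimately show ?thesis by (simp only: norm_of_real power2_abs)
  qed
  have "(\<rho>' m - rho l g m) * (1 * g m)\<^sup>2 \<le> 0"
  proof (rule tendsto_le)
    show "(\<lambda>N::nat. (\<rho>' m - rho l g m) * (log_cutoff l (int N) m * g m)\<^sup>2)
        \<longlonglongrightarrow> (\<rho>' m - rho l g m) * (1 * g m)\<^sup>2"
      by (intro tendsto_intros log_cutoff_tendsto_1)
    show "(\<lambda>N::nat. K / ln (real_of_int (int N))) \<longlonglongrightarrow> 0"
      unfolding of_int_of_nat_eq
      by (intro real_tendsto_divide_at_top[OF tendsto_const] filterlim_compose[OF ln_at_top]
          filterlim_real_sequentially)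
    show "\<forall>\<^sub>F N in sequentially. (\<rho>' m - rho l g m) * (log_cutoff l (int N) m * g m)\<^sup>2
        \<le> K / ln (real_of_int (int N))"
      using eventually_ge_at_top[of "nat (max 3 m)"] by eventually_elim (rule bound, simp only: nat_le_iff)
  qed simp
  moreover have "g m > 0" using dvg_pos[of 0 m] l_pos m by simp
  ultimately have "\<rho>' m \<le> rho l g m" by (simp add: mult_le_0_iff power2_eq_square)
  then show "\<rho>' m = rho l g m" using ge[OF m] by simp
qed

section \<open>Optimality near infinity\<close>
text \<open>The numerator of \<open>rho\<close> has size \<open>n powr (- l - s)\<close> and \<open>g\<close> has size \<open>n powr (l - s)\<close>, so their product
has size \<open>n powr (- 2 * s)\<close>. Its limiting constant is nonzero by the expansion and nonnegative since the
numerator is, hence positive.\<close>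
lemma rho_g_square_lower:
  assumes "s \<le> 1/2"
  obtains c n0 where "0 < c" "1 \<le> n0" "int l \<le> n0"
    "\<And>n. n0 \<le> n \<Longrightarrow> c * (1 / real_of_int n) \<le> rho l g n * (g n)\<^sup>2"
proof -
  from asymptotics obtain c where c: "\<forall>m\<le>2 * l. (\<lambda>n::nat. dg m (int n) / real n powr (\<gamma> - real m)) \<longlonglongrightarrow> c m"
    "\<forall>m. c m \<noteq> 0" "\<forall>k\<le>l. c k > 0"
    by (elim exE conjE) (rule that)
  define d where "d = (-1) ^ l * c (2 * l) * c 0"
  have "(\<lambda>n::nat. (-1) ^ l * (dg (2 * l) (int n + - int l) / real n powr (\<gamma> - real (2 * l)))
      * (dg 0 (int n) / real n powr (\<gamma> - real 0))) \<longlonglongrightarrow> d"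
    unfolding d_def by (intro tendsto_intros tendsto_shift_powr c(1)[rule_format]) auto
  moreover have "(-1) ^ l * (dg (2 * l) (int n + - int l) / real n powr (\<gamma> - real (2 * l)))
      * (dg 0 (int n) / real n powr (\<gamma> - real 0)) = flux 0 (int n) * g (int n) / real n powr (- 2 * s)" for n :: nat
  proof -
    have "real n powr (\<gamma> - real (2 * l)) * real n powr (\<gamma> - real 0) = real n powr (- 2 * s)"
      by (simp add: powr_add[symmetric])
    then show ?thesis by (simp add: flux_eq_dvg)
  qed
  ultimately have lim: "(\<lambda>n::nat. flux 0 (int n) * g (int n) / real n powr (- 2 * s)) \<longlonglongrightarrow> d" by simp
  have "0 \<le> d"
  proof (rule tendsto_lowerbound[OF lim])
    show "\<forall>\<^sub>F n in sequentially. 0 \<le> flux 0 (int n) * g (int n) / real n powr (- 2 * s)"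
      using eventually_ge_at_top[of l]
    proof eventually_elim
      case (elim n)
      then have "0 \<le> flux 0 (int n)" "0 < g (int n)"
        using flux_nonneg[of 0 "int n"] dvg_pos[of 0 "int n"] l_pos by auto
      then show ?case by simp
    qed
  qed simp
  moreover have "d \<noteq> 0" using c(2) by (simp add: d_def)
  ultimately have "d / 2 < d" "0 < d / 2" by auto
  from order_tendstoD(1)[OF lim this(1)] obtain n1 where
    n1: "\<And>n. n1 \<le> n \<Longrightarrow> d / 2 < flux 0 (int n) * g (int n) / real n powr (- 2 * s)"
    by (auto simp: eventually_sequentially)
  show ?thesis
  proof (rule that[of "d / 2" "int (n1 + l)"])
    fix n assume n: "int (n1 + l) \<le> n"
    then have n': "1 \<le> n" "int l \<le> n" "n1 \<le> nat n" using l_pos by auto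
    then have "d / 2 * real_of_int n powr (- 2 * s) \<le> flux 0 n * g n"
      using n1[of "nat n"] by (simp add: less_divide_eq)
    moreover have "real_of_int n powr (- 1) \<le> real_of_int n powr (- 2 * s)"
      using n' assms by (intro powr_mono) auto
    then have "d / 2 * real_of_int n powr (- 1) \<le> d / 2 * real_of_int n powr (- 2 * s)"
      using \<open>0 < d / 2\<close> by (intro mult_left_mono) auto
    moreover have "flux 0 n * g n = rho l g n * (g n)\<^sup>2"
      using weight_mult_dg[of 0 n] n' by (simp add: rho_eq_weight power2_eq_square)
    ultimately have "d / 2 * real_of_int n powr (- 1) \<le> rho l g n * (g n)\<^sup>2" by linarith
    moreover have "real_of_int n powr (- 1) = 1 / real_of_int n"
      using n' by (simp add: powr_minus divide_simps)
    ultimately show "d / 2 * (1 / real_of_int n) \<le> rho l g n * (g n)\<^sup>2" by (simp only:)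
  qed (use l_pos \<open>0 < d / 2\<close> in auto)
qed

lemma rho_g_square_divergent:
  assumes "s \<le> 1/2" "int l \<le> M"
  obtains K where "M \<le> K" "T < (\<Sum>n=M..K. rho l g n * (g n)\<^sup>2)"
proof -
  obtain c n0 where c: "0 < c" "1 \<le> n0" "int l \<le> n0"
    "\<And>n. n0 \<le> n \<Longrightarrow> c * (1 / real_of_int n) \<le> rho l g n * (g n)\<^sup>2"
    using rho_g_square_lower[OF assms(1)] by blast
  define a where "a = max M n0"
  have a: "1 \<le> a" "n0 \<le> a" "M \<le> a" using c(2) by (auto simp: a_def)
  have "filterlim (\<lambda>K::nat. ln (real K)) at_top sequentially"
    by (intro filterlim_compose[OF ln_at_top] filterlim_real_sequentially)
  then have "\<forall>\<^sub>F K::nat in sequentially. T / c + ln (real_of_int a) < ln (real K)"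
    by (simp add: filterlim_at_top_dense)
  then have "\<forall>\<^sub>F K::nat in sequentially. T / c + ln (real_of_int a) < ln (real K) \<and> K \<ge> nat a"
    by (intro eventually_conj eventually_ge_at_top)
  then obtain K :: nat where K: "T / c + ln (real_of_int a) < ln (real K)" "nat a \<le> K"
    using eventually_happens by force
  have aK: "a \<le> int K" using K(2) by linarith
  have "T < c * (ln (real K) - ln (real_of_int a))" using K(1) c(1) by (simp add: field_simps)
  also have "\<dots> \<le> c * (\<Sum>n=a..int K. 1 / real_of_int n)"
  proof (intro mult_left_mono)
    have "ln (real K) \<le> ln (real_of_int (int K + 1))" using aK a(1) by simp
    also have "\<dots> - ln (real_of_int a) \<le> (\<Sum>n=a..int K. 1 / real_of_int n)"
      by (rule sum_inverse_ge_ln[OF a(1) aK])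
    finally show "ln (real K) - ln (real_of_int a) \<le> (\<Sum>n=a..int K. 1 / real_of_int n)" by simp
  qed (use c(1) in simp)
  also have "\<dots> \<le> (\<Sum>n=a..int K. rho l g n * (g n)\<^sup>2)"
    unfolding sum_distrib_left using c(4) a by (intro sum_mono) auto
  also have "\<dots> \<le> (\<Sum>n=M..int K. rho l g n * (g n)\<^sup>2)"
    using a rho_nonneg assms(2) by (intro sum_mono2) auto
  finally show ?thesis using aK a by (intro that[of "int K"]) auto
qed


text \<open>The deficit is a quadratic form. Together with its nonnegativity this bounds the deficit of a difference by
the deficits of the two sequences.\<close>
lemma deficit_parallelogram:
  "deficit N (\<lambda>n. u n - v n) + deficit N (\<lambda>n. u n + v n) = 2 * deficit N u + 2 * deficit N v"
proof -
  have weighted: "w * a + w * b = 2 * (w * c) + 2 * (w * d)" if "a + b = 2 * c + 2 * d" for w a b c d :: real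
  proof -
    have "w * (a + b) = w * (2 * c + 2 * d)" using that by simp
    then show ?thesis by (simp add: algebra_simps)
  qed
  have "energy k N (\<lambda>n. u n - v n) + energy k N (\<lambda>n. u n + v n) = 2 * energy k N u + 2 * energy k N v" for k
  proof -
    have "energy k N (\<lambda>n. u n - v n) + energy k N (\<lambda>n. u n + v n)
        = (\<Sum>n=int l - int k..N. weight k n * (cmod ((dvg ^^ k) u n - (dvg ^^ k) v n))\<^sup>2
          + weight k n * (cmod ((dvg ^^ k) u n + (dvg ^^ k) v n))\<^sup>2)"
      unfolding energy_def dvg_funpow_diff dvg_funpow_add by (rule sum.distrib[symmetric])
    also have "\<dots> = (\<Sum>n=int l - int k..N. 2 * (weight k n * (cmod ((dvg ^^ k) u n))\<^sup>2)
          + 2 * (weight k n * (cmod ((dvg ^^ k) v n))\<^sup>2))"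
      by (intro sum.cong refl weighted cmod_parallelogram)
    also have "\<dots> = 2 * energy k N u + 2 * energy k N v"
      unfolding energy_def by (simp only: sum.distrib sum_distrib_left)
    finally show ?thesis .
  qed
  note parts = this
  have difference: "(a - a') + (b - b') = 2 * (c - c') + 2 * (d - d')"
    if "a + b = 2 * c + 2 * d" "a' + b' = 2 * c' + 2 * d'" for a a' b b' c c' d d' :: real
  proof -
    have "(a - a') + (b - b') = (a + b) - (a' + b')" by simp
    also have "\<dots> = 2 * (c - c') + 2 * (d - d')" unfolding that by simp
    finally show ?thesis .
  qed
  show ?thesis unfolding deficit_def by (rule difference[OF parts parts])
qed

lemma energy_0_nonneg: "0 \<le> energy 0 N u"
  unfolding energy_0 by (intro sum_nonneg mult_nonneg_nonneg rho_nonneg) auto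

text \<open>The part of the trial sequence left of \<open>M\<close> depends on \<open>N\<close>, but only through cutoff values between
0 and 1, and it lives on a fixed finite set.\<close>
lemma deficit_head_bound:
  "\<exists>D. \<forall>N\<ge>max 3 M. deficit N (\<lambda>n. if n < M then trial N n else 0) \<le> D"
proof -
  define G where "G = (\<Sum>n=int l..M. \<bar>g n\<bar>)"
  have "deficit N (\<lambda>n. if n < M then trial N n else 0) \<le> (\<Sum>n=0..M. (2 ^ l * G)\<^sup>2)" if "max 3 M \<le> N" for N
  proof -
    have N: "3 \<le> N" "M \<le> N" using that by auto
    have L: "1 \<le> ln (real_of_int N)" by (rule ln_ge_1[OF N(1)])
    define a where "a n = (if n < M then log_cutoff l N n * g n else 0)" for n
    have a_eq: "(\<lambda>n. if n < M then trial N n else 0) = (\<lambda>n. complex_of_real (a n))"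
      by (auto simp: a_def)
    have a_le: "\<bar>a n\<bar> \<le> G" for n
    proof (cases "int l \<le> n \<and> n < M")
      case True
      then have "\<bar>log_cutoff l N n\<bar> \<le> 1"
        using L l_pos unfolding log_cutoff_def by (auto simp: power_le_one_iff power_abs[symmetric] intro!: power_le_one)
      then have "\<bar>a n\<bar> \<le> 1 * \<bar>g n\<bar>"
        using True unfolding a_def by (simp only: abs_mult if_True simp_thms) (intro mult_right_mono, auto)
      also have "1 * \<bar>g n\<bar> \<le> G"
        unfolding G_def using True by (simp only: mult_1_left) (intro member_le_sum, auto)
      finally show ?thesis .
    next
      case False
      then have "a n = 0" using g_eq_0[of n] by (auto simp: a_def)
      then show ?thesis by (simp add: G_def sum_nonneg)
    qed
    have "deficit N (\<lambda>n. complex_of_real (a n)) \<le> energy l N (\<lambda>n. complex_of_real (a n))"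
      using energy_0_nonneg by (simp add: deficit_def)
    also have "\<dots> = (\<Sum>n=0..N. ((dvg ^^ l) a n)\<^sup>2)"
      by (simp add: energy_top dvg_funpow_of_real)
    also have "\<dots> = (\<Sum>n=0..M. ((dvg ^^ l) a n)\<^sup>2)"
      using N by (intro sum.mono_neutral_right) (auto intro!: dvg_funpow_eq_0 simp: a_def)
    also have "\<dots> \<le> (\<Sum>n=0..M. (2 ^ l * G)\<^sup>2)"
    proof (rule sum_mono)
      fix n
      have "\<bar>(dvg ^^ l) a n\<bar>\<^sup>2 \<le> (2 ^ l * G)\<^sup>2"
        by (intro power_mono abs_dvg_funpow_le a_le) auto
      then show "((dvg ^^ l) a n)\<^sup>2 \<le> (2 ^ l * G)\<^sup>2" by simp
    qed
    finally show ?thesis unfolding a_eq .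
  qed
  then show ?thesis by blast
qed

text \<open>The part of the trial sequence to the right of \<open>M\<close> is the difference of the trial sequence and its head, so
its deficit stays bounded as \<open>N\<close> grows. Its right-hand side is unbounded, because the sum of
\<open>rho l g n * (g n)\<^sup>2\<close> diverges like the harmonic series. So the ratio of both sides tends to 1.\<close>
lemma optimal_near_infinity:
  assumes "s = 1/2"
  shows "optimal_near_infinity_weight l (rho l g)"
  unfolding optimal_near_infinity_weight_def
proof (intro conjI hrb_weight_rho allI impI)
  fix M :: int and \<epsilon> :: real
  assume M: "int l \<le> M" and \<epsilon>: "0 < \<epsilon>"
  obtain K where K: "K > 0"
    "\<And>N. max 3 (int l) \<le> N \<Longrightarrow> deficit N (trial N) \<le> K / ln (real_of_int N)"
    using deficit_trial_bound assms by auto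
  obtain D where D: "\<And>N. max 3 M \<le> N \<Longrightarrow> deficit N (\<lambda>n. if n < M then trial N n else 0) \<le> D"
    using deficit_head_bound[of M] by blast
  \<comment> \<open>\<open>2 * K + 2 * D\<close> bounds the deficit of the truncated sequence, uniformly in \<open>N\<close>.\<close>
  define T where "T = (2 * K + 2 * D) / \<epsilon>"
  obtain R where R: "M \<le> R" "T < (\<Sum>n=M..R. rho l g n * (g n)\<^sup>2)"
    using rho_g_square_divergent[OF _ M] assms by (metis order_refl)
  have "(\<lambda>N::nat. \<Sum>n=M..R. rho l g n * (log_cutoff l (int N) n * g n)\<^sup>2)
      \<longlonglongrightarrow> (\<Sum>n=M..R. rho l g n * (1 * g n)\<^sup>2)"
    by (intro tendsto_intros log_cutoff_tendsto_1)
  then have "\<forall>\<^sub>F N::nat in sequentially. T < (\<Sum>n=M..R. rho l g n * (log_cutoff l (int N) n * g n)\<^sup>2)"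
    by (rule order_tendstoD(1)) (use R(2) in simp)
  then have "\<forall>\<^sub>F N::nat in sequentially. T < (\<Sum>n=M..R. rho l g n * (log_cutoff l (int N) n * g n)\<^sup>2)
      \<and> nat (max 3 R) \<le> N"
    by (intro eventually_conj eventually_ge_at_top)
  then obtain N' :: nat where
    N': "T < (\<Sum>n=M..R. rho l g n * (log_cutoff l (int N') n * g n)\<^sup>2)" "nat (max 3 R) \<le> N'"
    using eventually_happens by force
  define N where "N = int N'"
  have T: "T < (\<Sum>n=M..R. rho l g n * (log_cutoff l N n * g n)\<^sup>2)" using N'(1) by (simp add: N_def)
  have N: "3 \<le> N" "R \<le> N" "M \<le> N" "int l \<le> N" using N'(2) R(1) M by (auto simp: N_def)
  define h where "h n = (if n < M then trial N n else 0)" for n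
  define u where "u n = trial N n - h n" for n
  have zero: "u n = 0" "h n = 0" if "n > N" for n
    using trial_support(2)[OF N(1) that] that N(3) by (auto simp: u_def h_def)
  have u_left: "u n = 0" if "n < M" for n using that by (simp add: u_def h_def)
  have "{n. u n \<noteq> 0} \<subseteq> {M..N}" using u_left zero(1) by (force simp: not_less[symmetric])
  then have u: "u \<in> H0_space M"
    using finite_subset u_left by (auto simp: H0_space_def H_space_def)
  have h: "h \<in> H_space (int l)"
    using trial_support(1)[OF N(1)] by (auto simp: H_space_def h_def)
  have "0 \<le> deficit N (\<lambda>n. trial N n + h n)"
    using trial_support[OF N(1)] h zero N by (intro deficit_nonneg) (auto simp: H_space_def)
  then have "deficit N u \<le> 2 * deficit N (trial N) + 2 * deficit N h"
    using deficit_parallelogram[of N "trial N" h] by (simp add: u_def[abs_def])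
  also have "\<dots> \<le> 2 * K + 2 * D"
  proof -
    have "deficit N (trial N) \<le> K / ln (real_of_int N)" using N by (intro K(2)) auto
    also have "\<dots> \<le> K" using ln_ge_1[OF N(1)] K(1) by (simp add: divide_le_eq)
    finally show ?thesis using D[of N] N by (simp add: h_def[abs_def])
  qed
  also have "\<dots> = \<epsilon> * T" using \<epsilon> by (simp add: T_def)
  also have "\<dots> < \<epsilon> * energy 0 N u"
  proof (intro mult_strict_left_mono \<epsilon>)
    have "(\<Sum>n=M..R. rho l g n * (log_cutoff l N n * g n)\<^sup>2) = (\<Sum>n=M..R. rho l g n * (cmod (u n))\<^sup>2)"
    proof (rule sum.cong[OF refl])
      fix n assume "n \<in> {M..R}"
      then have "u n = of_real (log_cutoff l N n * g n)" by (simp add: u_def h_def)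
      then show "rho l g n * (log_cutoff l N n * g n)\<^sup>2 = rho l g n * (cmod (u n))\<^sup>2"
        by (simp only: norm_of_real power2_abs)
    qed
    also have "\<dots> \<le> energy 0 N u"
      unfolding energy_0 using M N rho_nonneg by (intro sum_mono2) auto
    finally show "T < energy 0 N u" using T by linarith
  qed
  finally have "energy l N u < (1 + \<epsilon>) * energy 0 N u" by (simp add: deficit_def distrib_right)
  moreover have "0 \<le> energy l N u" by (simp add: energy_top sum_nonneg)
  ultimately have "ennreal (energy l N u) < ennreal ((1 + \<epsilon>) * energy 0 N u)"
    by (intro ennreal_lessI) auto
  also have "\<dots> = ennreal (1 + \<epsilon>) * ennreal (energy 0 N u)"
    using \<epsilon> energy_0_nonneg by (intro ennreal_mult) auto
  finally show "\<exists>u\<in>H0_space M. birman_lhs l u < ennreal (1 + \<epsilon>) * birman_rhs l (rho l g) u"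
    using u zero(1) by (intro bexI[of _ u]) (simp_all only: lhs_eq_energy[of N] rhs_eq_energy[of N])
qed

section \<open>Non-attainability\<close>
lemma remainder_0_eq_0_imp:
  assumes "0 < weight 1 n" "int l \<le> n" "remainder 0 u n = 0"
  shows "u (n + 1) / of_real (g (n + 1)) = u n / of_real (g n)"
proof -
  have "0 < g n" "0 < g (n + 1)"
    using assms(2) dvg_pos[of 0 n] dvg_pos[of 0 "n + 1"] l_pos by auto
  with assms(1) have pos: "0 < weight 1 n * g n * g (n + 1)" by (intro mult_pos_pos)
  have "weight 1 n * g n * g (n + 1) *
      (cmod (u (n + 1) / of_real (g (n + 1)) - u n / of_real (g n)))\<^sup>2 = 0"
    using assms(3) by (simp only: remainder_def funpow_0 One_nat_def)
  with pos have "(cmod (u (n + 1) / of_real (g (n + 1)) - u n / of_real (g n)))\<^sup>2 = 0"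
    by (metis less_irrefl mult_eq_0_iff)
  then show ?thesis by (simp only: power_eq_0_iff norm_eq_zero right_minus_eq)
qed

text \<open>If both sides agree and are finite, a positive remainder at a single \<open>m\<close> would keep every partial sum of
the right-hand side below the total by that amount.\<close>
lemma attained_imp_remainder_eq_0:
  assumes u: "u \<in> H_space (int l)"
    and summable: "(\<lambda>n. rho l g n * (cmod (u n))\<^sup>2) summable_on {int l..}"
    and eq: "birman_lhs l u = birman_rhs l (rho l g) u"
    and m: "int l \<le> m"
  shows "remainder 0 u m = 0"
proof -
  let ?r = "\<lambda>n. rho l g n * (cmod (u n))\<^sup>2"
  have r: "0 \<le> ?r n" if "int l \<le> n" for n using rho_nonneg[OF that] by simp
  define S where "S = infsum ?r {int l..}"
  have S: "0 \<le> S" unfolding S_def by (intro infsum_nonneg) (use r in auto)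
  have lhs: "birman_lhs l u = ennreal S"
    unfolding eq birman_rhs_def S_def using r by (intro infsum_ennreal_of_summable summable) auto
  \<comment> \<open>The partial sums of the left-hand side stay below the finite common value.\<close>
  have energy_le: "energy l N u \<le> S" for N
  proof -
    have "ennreal (energy l N u) = (\<Sum>n\<in>{0..N}. ennreal ((cmod ((dvg ^^ l) u n))\<^sup>2))"
      unfolding energy_top by (rule sum_ennreal[symmetric]) simp
    also have "\<dots> \<le> (SUP F\<in>{F. finite F \<and> F \<subseteq> {0..}}. \<Sum>n\<in>F. ennreal ((cmod ((dvg ^^ l) u n))\<^sup>2))"
      by (rule SUP_upper) auto
    also have "\<dots> = birman_lhs l u"
      unfolding birman_lhs_eq by (rule nonneg_infsum_complete[symmetric]) simp
    finally show ?thesis unfolding lhs using S by (simp only: ennreal_le_iff)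
  qed
  obtain N0 where N0: "int l \<le> N0" "\<And>k n. k < l \<Longrightarrow> N0 \<le> n \<Longrightarrow> 0 \<le> flux (Suc k) n"
    using eventually_flux_nonneg by blast
  have "sum ?r F \<le> S - remainder 0 u m" if F: "finite F" "F \<subseteq> {int l..}" for F
  proof -
    define N where "N = Max (insert N0 (insert m F))"
    have le: "x \<le> N" if "x \<in> insert N0 (insert m F)" for x
      unfolding N_def using that F(1) by (intro Max_ge) auto
    have N: "N0 \<le> N" "m \<le> N" by (rule le, simp)+
    have FN: "F \<subseteq> {int l..N}"
    proof
      fix x assume "x \<in> F"
      then show "x \<in> {int l..N}" using F(2) le[of x] by auto
    qed
    have "sum ?r F \<le> energy 0 N u"
      unfolding energy_0 using FN r by (intro sum_mono2) auto
    moreover have "remainder 0 u m \<le> deficit N u"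
      using N N0(1) m by (intro deficit_ge_remainder u N0(2)) auto
    ultimately show ?thesis using energy_le[of N] by (simp add: deficit_def)
  qed
  then have "S \<le> S - remainder 0 u m"
    unfolding S_def by (intro infsum_le_finite_sums summable)
  moreover have "0 \<le> remainder 0 u m" using l_pos m by (intro remainder_nonneg) auto
  ultimately show ?thesis by simp
qed

text \<open>In the case of equality the remainders with \<open>k = 0\<close> vanish, so \<open>u\<close> is a multiple of \<open>g\<close>. But the
right-hand side diverges at \<open>g\<close> when \<open>s \<le> 1/2\<close>.\<close>
lemma non_attainable:
  assumes s: "s \<le> 1/2" and weight_pos: "\<And>n. int l \<le> n \<Longrightarrow> 0 < weight 1 n"
  shows "non_attainable_weight l (rho l g)"
  unfolding non_attainable_weight_def
proof (intro conjI hrb_weight_rho ballI impI)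
  fix u :: "int \<Rightarrow> complex"
  assume u: "u \<in> H_space (int l)"
    and "(\<lambda>n. (cmod (complex_of_real (sqrt (rho l g n)) * u n))\<^sup>2) summable_on {int l..} \<and>
      birman_lhs l u = birman_rhs l (rho l g) u"
  then have sq: "(\<lambda>n. (cmod (complex_of_real (sqrt (rho l g n)) * u n))\<^sup>2) summable_on {int l..}"
    and eq: "birman_lhs l u = birman_rhs l (rho l g) u" by auto
  have summable: "(\<lambda>n. rho l g n * (cmod (u n))\<^sup>2) summable_on {int l..}"
    using sq by (rule summable_on_cong[THEN iffD1, rotated])
      (use rho_nonneg in \<open>simp add: norm_mult power_mult_distrib\<close>)
  define c where "c = u (int l) / of_real (g (int l))"
  have ratio: "u n / of_real (g n) = c" if "int l \<le> n" for n
    using that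
  proof (induction n rule: int_ge_induct)
    case (step n)
    then show ?case
      using remainder_0_eq_0_imp[OF weight_pos[OF step.hyps] step.hyps
          attained_imp_remainder_eq_0[OF u summable eq step.hyps]] by simp
  qed (simp add: c_def)
  have u_eq: "u n = c * of_real (g n)" if "int l \<le> n" for n
    using ratio[OF that] dvg_pos[of 0 n] l_pos that by (auto simp: field_simps)
  have "c = 0"
  proof (rule ccontr)
    assume "c \<noteq> 0"
    define S where "S = infsum (\<lambda>n. rho l g n * (cmod (u n))\<^sup>2) {int l..}"
    obtain K where K: "S / (cmod c)\<^sup>2 < (\<Sum>n=int l..K. rho l g n * (g n)\<^sup>2)"
      using rho_g_square_divergent[OF s order_refl] by metis
    have "S < (cmod c)\<^sup>2 * (\<Sum>n=int l..K. rho l g n * (g n)\<^sup>2)"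
      using K \<open>c \<noteq> 0\<close> by (simp add: divide_less_eq mult.commute)
    also have "\<dots> = (\<Sum>n=int l..K. rho l g n * (cmod (u n))\<^sup>2)"
      unfolding sum_distrib_left
      by (intro sum.cong) (simp_all add: u_eq norm_mult power_mult_distrib)
    also have "\<dots> \<le> S"
      unfolding S_def using rho_nonneg by (intro finite_sum_le_infsum summable) auto
    finally show False by simp
  qed
  then show "u = (\<lambda>n. 0)"
    using u u_eq by (fastforce simp: H_space_def fun_eq_iff not_less)
qed

end

theorem theorem3:
  fixes l :: nat and s :: real and g :: "int \<Rightarrow> real"
  assumes "l \<ge> 1"
    and "g \<in> H_space (int l)"
    and A1: "\<And>k n. k < l \<Longrightarrow> n \<ge> int l - int k \<Longrightarrow> (dvg ^^ k) g n > 0"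
    and A2: "\<And>k n. 1 \<le> k \<Longrightarrow> k < l \<Longrightarrow> n \<ge> int l + 1 - int k \<Longrightarrow>
               (neg_lap ^^ (l - k)) ((dvg ^^ k) g) n \<ge> 0"
    and s: "0 < s" "s < 1"
    and E: "has_power_expansion l s g"
  shows
    "((\<forall>n\<ge>int l. (neg_lap ^^ l) g n \<ge> 0) \<longrightarrow>
        (s \<ge> 1/2 \<longrightarrow> critical_weight l (rho l g)) \<and>
        (s = 1/2 \<longrightarrow> optimal_near_infinity_weight l (rho l g)) \<and>
        (s \<le> 1/2 \<and> (\<forall>n\<ge>int l. (neg_lap ^^ l) g n > 0) \<and>
         (l \<ge> 2 \<longrightarrow> (\<forall>n\<ge>int l. (neg_lap ^^ (l - 1)) (dvg g) n > 0))
           \<longrightarrow> non_attainable_weight l (rho l g))) \<and>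
     (s = 1/2 \<and> (\<forall>n\<ge>int l. (neg_lap ^^ l) g n > 0) \<and>
      (l \<ge> 2 \<longrightarrow> (\<forall>n\<ge>int l. (neg_lap ^^ (l - 1)) (dvg g) n > 0))
        \<longrightarrow> (\<forall>n\<ge>int l. rho l g n > 0) \<and> optimal_weight l (rho l g))"
proof -
  let ?nonneg = "\<forall>n\<ge>int l. (neg_lap ^^ l) g n \<ge> 0"
  let ?strict = "\<forall>n\<ge>int l. (neg_lap ^^ l) g n > 0"
  let ?strict' = "l \<ge> 2 \<longrightarrow> (\<forall>n\<ge>int l. (neg_lap ^^ (l - 1)) (dvg g) n > 0)"
  have ground: "birman_ground_state l s g" if ?nonneg
    using that assms by unfold_locales auto
  have crit: "critical_weight l (rho l g)" if ?nonneg "s \<ge> 1/2"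
    using birman_ground_state.critical[OF ground] that by blast
  have near: "optimal_near_infinity_weight l (rho l g)" if ?nonneg "s = 1/2"
    using birman_ground_state.optimal_near_infinity[OF ground] that by blast
  have attain: "non_attainable_weight l (rho l g)" if nonneg: ?nonneg and "s \<le> 1/2" and strict': ?strict'
  proof -
    interpret birman_ground_state l s g by (rule ground[OF nonneg])
    have "0 < weight 1 n" if "int l \<le> n" for n
      unfolding weight_def flux_def using strict' that A1[of 1 n] l_pos by (cases "l = 1") auto
    with \<open>s \<le> 1/2\<close> show ?thesis by (rule non_attainable)
  qed
  have pos: "0 < rho l g n" if ?strict "int l \<le> n" for n
    using that A1[of 0 n] \<open>l \<ge> 1\<close> by (simp add: rho_def)
  have nonneg: ?nonneg if ?strict using that by (auto intro: less_imp_le)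
  show ?thesis
    using crit near attain pos nonneg unfolding optimal_weight_def by auto
qed

end
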